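(* Let $g:\mathbb{N}\to\mathbb{R}_{>0}$ be a polynomial and $\epsilon>0$ a constant. There is an algorithm running in time $(m n')^{O(1)}$ that, given a 3-SAT formula $\phi$ on variables $X_1,\dots,X_{n'}$ with clauses $C_1,\dots,C_m$, computes an instance $\mathcal{I}$ of $g(n)$-FR-$k$-Med-O of size $n$ such that: (1) $|C|=m$, $|F|=8m$, $n=9m+1$, $k=m$, and the number of groups satisfies $t\le 2n'm^2+m$; (2) if some assignment satisfies all clauses of $\phi$, then $\mathcal{I}$ has a feasible solution of cost at most $k$; (3) if every assignment satisfies fewer than a $(7/8+\epsilon)$ fraction of the clauses, then every feasible solution of $\mathcal{I}$ has cost $>(1-8\epsilon)\frac{g(n)-2}{16}k$.
   Context: Fair-range $k$-median (FR-$k$-Med): an instance consists of positive integers $k,t$, a set $C$ of clients, a set $F$ of facilities, a metric $d$ on $C\cup F$ given as the shortest-path metric of a weighted graph $H$ whose vertex set contains $C\cup F$ ($n$ = number of vertices of $H$), groups $G_1,\dots,G_t\subseteq F$ (possibly intersecting) with integers $\alpha_i\le\beta_i$. A set $S\subseteq F$, $|S|\le k$, is feasible if $\alpha_i\le|S\cap G_i|\le\beta_i$ for all $i$; its cost is $\sum_{c\in C}d(c,S)$. FR-$k$-Med-O is FR-$k$-Med restricted to instances for which a feasible solution can be found in polynomial time; $g(n)$-FR-$k$-Med-O further requires the distance aspect ratio (maximum over minimum pairwise distance) to be at most $g(n)$.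
   Formalization: Adds that g(9m+1) ≥ 1 for all m ≥ 1 (no metric has aspect ratio below 1), and that ε ≤ 1/8 or g(9m+1) ≥ 2 for all m ≥ 1 (for large ε with g < 2, (3) would contradict (2)). *)

theory Defs
  imports
    "HOL-Library.Extended_Real"
    "HOL-Library.Log_Nat"
    "HOL-Computational_Algebra.Polynomial"
    "Graph_Theory.Graph_Theory"
begin

section \<open>Algorithms and running time\<close>

text \<open>
  Algorithms are programs of a small expression language with an unbounded while loop, working on
  binary trees with integer leaves. The measure of time is logarithmic: a value is charged its bit
  size each time it is looked up or produced by a primitive operation. In particular numbers and
  trees cannot grow faster than the time spent on them, and every primitive operation is computable
  on a Turing machine in time polynomial in the sizes of its operands and its result, all of which
  have been charged. Hence polynomial time in this model is polynomial time in the usual sense.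
\<close>

datatype val = Num int | Node val val

fun vsize :: "val \<Rightarrow> nat" where
  "vsize (Num i) = Suc (nat (bitlen \<bar>i\<bar>))"
| "vsize (Node u v) = Suc (vsize u + vsize v)"

fun int_of :: "val \<Rightarrow> int" where
  "int_of (Num i) = i"
| "int_of (Node u v) = 0"

datatype unop = Head | Tail | IsNode

datatype binop = MkNode | Plus | Minus | Times | Div | Mod | Less | Equal

fun truth :: "bool \<Rightarrow> val" where
  "truth b = Num (if b then 1 else 0)"

text \<open>All operations are total; ill-typed operands give default values.\<close>

fun unop_val :: "unop \<Rightarrow> val \<Rightarrow> val" where
  "unop_val Head (Node u v) = u"
| "unop_val Tail (Node u v) = v"
| "unop_val IsNode (Node u v) = truth True"
| "unop_val _ (Num i) = Num 0"

fun binop_val :: "binop \<Rightarrow> val \<Rightarrow> val \<Rightarrow> val" where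
  "binop_val MkNode u v = Node u v"
| "binop_val Plus u v = Num (int_of u + int_of v)"
| "binop_val Minus u v = Num (int_of u - int_of v)"
| "binop_val Times u v = Num (int_of u * int_of v)"
| "binop_val Div u v = Num (int_of u div int_of v)"
| "binop_val Mod u v = Num (int_of u mod int_of v)"
| "binop_val Less u v = truth (int_of u < int_of v)"
| "binop_val Equal u v = truth (int_of u = int_of v)"

type_synonym vname = string

datatype prog =
    Var vname
  | Const int
  | Unary unop prog
  | Binary binop prog prog
  | Cond prog prog prog
  | LetIn vname prog prog
  | While vname prog prog

text \<open>
  The relation \<open>eval \<sigma> p v t\<close>: in the environment \<open>\<sigma>\<close>, program \<open>p\<close> returns
  \<open>v\<close> after time \<open>t\<close>. \<open>While x c p\<close> repeats \<open>x := p\<close> as long as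
  \<open>c\<close> is nonzero, and returns the final value of \<open>x\<close>; the assignments to \<open>x\<close> are
  local to the loop.
\<close>

inductive eval :: "(vname \<Rightarrow> val) \<Rightarrow> prog \<Rightarrow> val \<Rightarrow> nat \<Rightarrow> bool" where
  eval_Var: "eval \<sigma> (Var x) (\<sigma> x) (vsize (\<sigma> x))"
| eval_Const: "eval \<sigma> (Const i) (Num i) (vsize (Num i))"
| eval_Unary: "eval \<sigma> p u s \<Longrightarrow> eval \<sigma> (Unary f p) (unop_val f u) (s + vsize (unop_val f u))"
| eval_Binary: "eval \<sigma> p u s \<Longrightarrow> eval \<sigma> q v t \<Longrightarrow>
    eval \<sigma> (Binary f p q) (binop_val f u v) (s + t + vsize (binop_val f u v))"
| eval_Cond: "eval \<sigma> c b s \<Longrightarrow> eval \<sigma> (if b \<noteq> Num 0 then p else q) v t \<Longrightarrow>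
    eval \<sigma> (Cond c p q) v (s + t)"
| eval_LetIn: "eval \<sigma> p u s \<Longrightarrow> eval (\<sigma>(x := u)) q v t \<Longrightarrow> eval \<sigma> (LetIn x p q) v (s + t)"
| eval_While_stop: "eval \<sigma> c (Num 0) s \<Longrightarrow>
    eval \<sigma> (While x c p) (\<sigma> x) (s + vsize (\<sigma> x))"
| eval_While_step: "eval \<sigma> c b r \<Longrightarrow> b \<noteq> Num 0 \<Longrightarrow> eval \<sigma> p u s \<Longrightarrow>
    eval (\<sigma>(x := u)) (While x c p) v t \<Longrightarrow> eval \<sigma> (While x c p) v (r + s + t)"

lemma eval_deterministic: "eval \<sigma> p u s \<Longrightarrow> eval \<sigma> p v t \<Longrightarrow> u = v \<and> s = t"
proof (induction arbitrary: v t rule: eval.induct)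
  case (eval_Var \<sigma> x)
  then show ?case by (auto elim: eval.cases)
next
  case (eval_Const \<sigma> i)
  then show ?case by (auto elim: eval.cases)
next
  case (eval_Unary \<sigma> p u s f)
  from eval_Unary.prems show ?case by cases (use eval_Unary.IH in blast)
next
  case (eval_Binary \<sigma> p u s q v t f)
  from eval_Binary.prems show ?case by cases (use eval_Binary.IH in blast)
next
  case (eval_Cond \<sigma> c b s p q v t)
  from eval_Cond.prems show ?case by cases (use eval_Cond.IH in blast)
next
  case (eval_LetIn \<sigma> p u s x q v t)
  from eval_LetIn.prems show ?case by cases (use eval_LetIn.IH in blast)
next
  case (eval_While_stop \<sigma> c s x p)
  from eval_While_stop.prems show ?case by cases (use eval_While_stop.IH in blast)+
next
  case (eval_While_step \<sigma> c b r p u s x v t)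
  from eval_While_step.prems show ?case by cases (use eval_While_step.IH eval_While_step.hyps in blast)+
qed

definition runs :: "prog \<Rightarrow> val \<Rightarrow> val \<Rightarrow> nat \<Rightarrow> bool" where
  "runs p inp out t \<longleftrightarrow> eval ((\<lambda>_. Num 0)(''input'' := inp)) p out t"

definition enc_nat :: "nat \<Rightarrow> val" where
  "enc_nat n = Num (int n)"

definition enc_rat :: "rat \<Rightarrow> val" where
  "enc_rat q = (case quotient_of q of (a, b) \<Rightarrow> Node (Num a) (Num b))"

definition enc_list :: "('a \<Rightarrow> val) \<Rightarrow> 'a list \<Rightarrow> val" where
  "enc_list enc xs = foldr (\<lambda>x v. Node (enc x) v) xs (Num 0)"

section \<open>3-SAT formulas\<close>

text \<open>
  The variables of a formula are the numbers below \<open>num_vars\<close>. Variables and literals may be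
  repeated within a clause, so clauses with one or two literals are covered as well.
\<close>

datatype literal = Pos nat | Neg nat

fun lit_var :: "literal \<Rightarrow> nat" where
  "lit_var (Pos x) = x"
| "lit_var (Neg x) = x"

fun lit_true :: "(nat \<Rightarrow> bool) \<Rightarrow> literal \<Rightarrow> bool" where
  "lit_true A (Pos x) = A x"
| "lit_true A (Neg x) = (\<not> A x)"

type_synonym clause = "literal \<times> literal \<times> literal"

fun clause_lits :: "clause \<Rightarrow> literal set" where
  "clause_lits (l1, l2, l3) = {l1, l2, l3}"

record sat3 =
  num_vars :: nat
  clauses :: "clause list"

definition wf_sat3 :: "sat3 \<Rightarrow> bool" where
  "wf_sat3 \<phi> \<longleftrightarrow> clauses \<phi> \<noteq> [] \<and>
     (\<forall>c \<in> set (clauses \<phi>). \<forall>l \<in> clause_lits c. lit_var l < num_vars \<phi>)"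

definition num_clauses :: "sat3 \<Rightarrow> nat" where
  "num_clauses \<phi> = length (clauses \<phi>)"

definition num_sat :: "sat3 \<Rightarrow> (nat \<Rightarrow> bool) \<Rightarrow> nat" where
  "num_sat \<phi> A = card {j. j < num_clauses \<phi> \<and> (\<exists>l \<in> clause_lits (clauses \<phi> ! j). lit_true A l)}"

fun enc_literal :: "literal \<Rightarrow> val" where
  "enc_literal (Pos x) = Node (Num 1) (enc_nat x)"
| "enc_literal (Neg x) = Node (Num 0) (enc_nat x)"

fun enc_clause :: "clause \<Rightarrow> val" where
  "enc_clause (l1, l2, l3) = enc_list enc_literal [l1, l2, l3]"

definition enc_sat3 :: "sat3 \<Rightarrow> val" where
  "enc_sat3 \<phi> = Node (enc_nat (num_vars \<phi>)) (enc_list enc_clause (clauses \<phi>))"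

section \<open>Fair-range k-median\<close>

text \<open>
  The graph of an instance has the vertices below \<open>num_verts\<close>. It is undirected, given as
  a symmetric digraph: every edge is listed as two arcs, with the same weight. A group is
  a list of facilities with its lower and its upper bound.
\<close>

record fr_inst =
  budget :: nat
  num_verts :: nat
  warcs :: "((nat \<times> nat) \<times> rat) list"
  clients :: "nat list"
  facilities :: "nat list"
  groups :: "(nat list \<times> int \<times> int) list"

definition inst_graph :: "fr_inst \<Rightarrow> nat pair_pre_digraph" where
  "inst_graph I = \<lparr>pverts = {..<num_verts I}, parcs = fst ` set (warcs I)\<rparr>"

definition inst_weight :: "fr_inst \<Rightarrow> (nat \<times> nat) weight_fun" where
  "inst_weight I e = of_rat (the (map_of (warcs I) e))"

definition inst_dist :: "fr_inst \<Rightarrow> nat \<Rightarrow> nat \<Rightarrow> real" where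
  "inst_dist I u v =
     real_of_ereal (wf_digraph.\<mu> (with_proj (inst_graph I)) (inst_weight I) u v)"

definition points :: "fr_inst \<Rightarrow> nat set" where
  "points I = set (clients I) \<union> set (facilities I)"

text \<open>
  Positivity of the weights and mutual reachability of the points make \<^const>\<open>inst_dist\<close> a metric
  on the points.
\<close>

definition wf_inst :: "fr_inst \<Rightarrow> bool" where
  "wf_inst I \<longleftrightarrow>
     budget I > 0 \<and> groups I \<noteq> [] \<and>
     distinct (map fst (warcs I)) \<and> pair_graph (inst_graph I) \<and>
     (\<forall>(u, v) \<in> parcs (inst_graph I).
        inst_weight I (u, v) > 0 \<and> inst_weight I (u, v) = inst_weight I (v, u)) \<and>
     distinct (clients I) \<and> distinct (facilities I) \<and> points I \<subseteq> {..<num_verts I} \<and>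
     (\<forall>u \<in> points I. \<forall>v \<in> points I. u \<rightarrow>\<^sup>*\<^bsub>with_proj (inst_graph I)\<^esub> v) \<and>
     (\<forall>(G, \<alpha>, \<beta>) \<in> set (groups I). set G \<subseteq> set (facilities I) \<and> \<alpha> \<le> \<beta>)"

definition feasible :: "fr_inst \<Rightarrow> nat set \<Rightarrow> bool" where
  "feasible I S \<longleftrightarrow> S \<subseteq> set (facilities I) \<and> card S \<le> budget I \<and>
     (\<forall>(G, \<alpha>, \<beta>) \<in> set (groups I). \<alpha> \<le> int (card (S \<inter> set G)) \<and> int (card (S \<inter> set G)) \<le> \<beta>)"

text \<open>The infimum is taken in the extended reals, so the distance to the empty set is infinite.\<close>

definition cost :: "fr_inst \<Rightarrow> nat set \<Rightarrow> ereal" where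
  "cost I S = (\<Sum>c \<in> set (clients I). INF s \<in> S. ereal (inst_dist I c s))"

definition aspect_ratio :: "fr_inst \<Rightarrow> real" where
  "aspect_ratio I =
     (let D = {inst_dist I u v | u v. u \<in> points I \<and> v \<in> points I \<and> u \<noteq> v} in Max D / Min D)"

definition enc_warc :: "(nat \<times> nat) \<times> rat \<Rightarrow> val" where
  "enc_warc a = (case a of ((u, v), w) \<Rightarrow> Node (Node (enc_nat u) (enc_nat v)) (enc_rat w))"

definition enc_group :: "nat list \<times> int \<times> int \<Rightarrow> val" where
  "enc_group G = (case G of (xs, \<alpha>, \<beta>) \<Rightarrow> Node (enc_list enc_nat xs) (Node (Num \<alpha>) (Num \<beta>)))"

definition enc_inst :: "fr_inst \<Rightarrow> val" where
  "enc_inst I = enc_list id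
     [enc_nat (budget I), enc_nat (num_verts I), enc_list enc_warc (warcs I),
      enc_list enc_nat (clients I), enc_list enc_nat (facilities I),
      enc_list enc_group (groups I)]"

text \<open>
  That a feasible solution can be found in polynomial time is a property of a class of instances:
  one algorithm has to serve all of them, given only the instance.
\<close>

definition FR_k_Med_O :: "fr_inst set \<Rightarrow> bool" where
  "FR_k_Med_O \<C> \<longleftrightarrow> (\<forall>I \<in> \<C>. wf_inst I) \<and>
     (\<exists>q a b. \<forall>I \<in> \<C>. \<exists>S t. runs q (enc_inst I) (enc_list enc_nat S) t \<and>
        feasible I (set S) \<and> t \<le> a * vsize (enc_inst I) ^ b)"

definition g_FR_k_Med_O :: "(nat \<Rightarrow> real) \<Rightarrow> fr_inst set \<Rightarrow> bool" where
  "g_FR_k_Med_O g \<C> \<longleftrightarrow> FR_k_Med_O \<C> \<and> (\<forall>I \<in> \<C>. aspect_ratio I \<le> g (num_verts I))"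

end

theory Submission
  imports Defs
begin

text \<open>
  Every clause becomes a cluster of one client and eight facilities, one for each assignment of values
  to its three literals' variables. Groups force exactly one facility per clause, and forbid
  facilities that contradict each other on a variable, so the feasible solutions are exactly the
  assignments; the all-false assignment is a feasible solution that can be written down at once.
  Points of a cluster have distance 1, except that the facility whose assignment falsifies the
  clause has, like all points outside the cluster, distance \<open>L\<close>. This is an ultrametric of aspect
  ratio \<open>L\<close>. A client pays 1 if the assignment satisfies its clause and \<open>L\<close> otherwise. It suffices that
  \<open>(g n - 2) / 2 \<le> L \<le> g n\<close>, so \<open>L\<close> can be chosen to be an integer that is easy to compute, although
  \<open>g\<close> itself need not be computable.

  The programs are compiled from expressions with bounded loops, whose running time is polynomial for
  structural reasons.
\<close>

section \<open>A language of polynomial-time expressions\<close>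

text \<open>The falsifying facility of a cluster is what puts the instance into the class. With only
  the seven facilities that satisfy a clause, feasibility would itself express satisfiability; with
  the eighth one present but far away, satisfiability moves from the constraints into the cost. The
  denominator 16 is 8 * 2: more than a fraction 1/8 - \<epsilon> of the clauses fails, each failure
  costs \<open>L\<close>, and \<open>L\<close> is only known to be at least (g n - 2) / 2. The
  factor 2 is lost by replacing \<open>g\<close> with a rational monomial, the summand 2 by rounding
  that monomial down. Bounding the time of a program in this cost model means bounding the size of
  every intermediate value, so this is done once, for a compiler. The program that finds a feasible
  solution meets a further obstacle: its time is measured against the bit size of the instance,
  whereas the compiler counts in unary. The gap closes because the instance lists more groups than
  the product of the numbers of clauses and of variables, so its bit size dominates the parameter in
  which the reduction is polynomial.\<close>

datatype bexp =
    BVar string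
  | BConst int
  | BUnary unop bexp
  | BBinary binop bexp bexp
  | BCond bexp bexp bexp
  | BLet string bexp bexp
  | BDrop bexp bexp
  | BLen bexp
  | BTab string bexp bexp bexp bexp

fun spine :: "val \<Rightarrow> nat" where
  "spine (Num i) = 0"
| "spine (Node u v) = Suc (spine v)"

text \<open>\<open>BTab i n c p r\<close> is a list comprehension with tail \<open>r\<close>. The
  number of rounds is fixed beforehand, and neither \<open>c\<close> nor \<open>p\<close> sees the
  list built so far, so a loop cannot feed its result back into itself. This rules out repeated
  squaring, and with it superpolynomial growth.\<close>

primrec den :: "bexp \<Rightarrow> (string \<Rightarrow> val) \<Rightarrow> val" where
  "den (BVar x) \<sigma> = \<sigma> x"
| "den (BConst i) \<sigma> = Num i"
| "den (BUnary f p) \<sigma> = unop_val f (den p \<sigma>)"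
| "den (BBinary f p q) \<sigma> = binop_val f (den p \<sigma>) (den q \<sigma>)"
| "den (BCond c p q) \<sigma> = (if den c \<sigma> \<noteq> Num 0 then den p \<sigma> else den q \<sigma>)"
| "den (BLet x p q) \<sigma> = den q (\<sigma>(x := den p \<sigma>))"
| "den (BDrop k l) \<sigma> = (unop_val Tail ^^ nat (int_of (den k \<sigma>))) (den l \<sigma>)"
| "den (BLen l) \<sigma> = Num (int (spine (den l \<sigma>)))"
| "den (BTab i n c p r) \<sigma> =
    foldr (\<lambda>j acc. if den c (\<sigma>(i := Num (int j))) \<noteq> Num 0
        then Node (den p (\<sigma>(i := Num (int j)))) acc else acc)
      [0..<nat (int_of (den n \<sigma>))] (den r \<sigma>)"

text \<open>Source variables are prefixed, so that they never clash with the loop state \<open>s\<close>.\<close>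

abbreviation cvar :: "string \<Rightarrow> vname" where
  "cvar x \<equiv> CHR ''v'' # x"

text \<open>One name \<open>s\<close> serves all loops although they nest, since each loop binds it
  by its own \<open>LetIn\<close>, which ends before an outer loop reads its state again. A state is
  a pair of a counter and a value. In \<open>BTab\<close> the counter runs down, because lists grow
  at the front.\<close>

primrec compile :: "bexp \<Rightarrow> prog" where
  "compile (BVar x) = Var (cvar x)"
| "compile (BConst i) = Const i"
| "compile (BUnary f p) = Unary f (compile p)"
| "compile (BBinary f p q) = Binary f (compile p) (compile q)"
| "compile (BCond c p q) = Cond (compile c) (compile p) (compile q)"
| "compile (BLet x p q) = LetIn (cvar x) (compile p) (compile q)"
| "compile (BDrop k l) =
    LetIn ''s'' (Binary MkNode (compile k) (compile l))
      (Unary Tail (While ''s'' (Binary Less (Const 0) (Unary Head (Var ''s'')))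
        (Binary MkNode (Binary Minus (Unary Head (Var ''s'')) (Const 1))
          (Unary Tail (Unary Tail (Var ''s''))))))"
| "compile (BLen l) =
    LetIn ''s'' (Binary MkNode (Const 0) (compile l))
      (Unary Head (While ''s'' (Unary IsNode (Unary Tail (Var ''s'')))
        (Binary MkNode (Binary Plus (Unary Head (Var ''s'')) (Const 1))
          (Unary Tail (Unary Tail (Var ''s''))))))"
| "compile (BTab i n c p r) =
    LetIn ''s'' (Binary MkNode (compile n) (compile r))
      (Unary Tail (While ''s'' (Binary Less (Const 0) (Unary Head (Var ''s'')))
        (LetIn (cvar i) (Binary Minus (Unary Head (Var ''s'')) (Const 1))
          (Binary MkNode (Var (cvar i))
            (Cond (compile c) (Binary MkNode (compile p) (Unary Tail (Var ''s'')))
              (Unary Tail (Var ''s'')))))))"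

text \<open>
  Numbers are measured in unary: loops count up to the value of a number, and this measure of the
  result is still polynomial in that of the operands for every primitive operation.
\<close>

fun usize :: "val \<Rightarrow> nat" where
  "usize (Num i) = Suc (nat \<bar>i\<bar>)"
| "usize (Node u v) = Suc (usize u + usize v)"

text \<open>\<open>Z\<close> bounds the loop states and \<open>N\<close> the number of rounds. A
  test or a round body of any of the three loops costs at most \<open>12 * Z + 10\<close>; a round
  is both, and \<open>Suc\<close> pays for the last test and for reading the state.
  \<open>3 * Z\<close> covers building the first state and projecting the last one.\<close>

definition loop_bound :: "nat \<Rightarrow> nat \<Rightarrow> nat" where
  "loop_bound N Z = 2 * (12 * Z + 10) * Suc N + 3 * Z"

text \<open>A single function of the size \<open>s\<close> of the variables bounds both the running
  time and the unary size of the result. Where a variable is bound, \<open>s\<close> grows by the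
  bound on its value.\<close>

primrec bound :: "bexp \<Rightarrow> nat \<Rightarrow> nat" where
  "bound (BVar x) s = s"
| "bound (BConst i) s = usize (Num i)"
| "bound (BUnary f p) s = 2 * bound p s + 1"
| "bound (BBinary f p q) s = bound p s + bound q s + (bound p s + bound q s + 1)\<^sup>2"
| "bound (BCond c p q) s = bound c s + bound p s + bound q s"
| "bound (BLet x p q) s = bound p s + bound q (s + bound p s)"
| "bound (BDrop k l) s = loop_bound (bound k s) (bound k s + bound l s + 2)"
| "bound (BLen l) s = loop_bound (bound l s) (2 * bound l s + 4)"
| "bound (BTab i n c p r) s =
    (let N = bound n s; Q = bound c (s + N) + bound p (s + N)
     in loop_bound N (N + bound r s + Suc N * Suc Q + 2))"

section \<open>Unary size under the primitive operations\<close>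

lemma bitlen_le: "i \<ge> 0 \<Longrightarrow> nat (bitlen i) \<le> nat i"
proof -
  assume "i \<ge> 0"
  have "i < 2 ^ nat i"
    using \<open>i \<ge> 0\<close> by (metis nat_0_le of_nat_less_two_power)
  then show ?thesis
    using \<open>i \<ge> 0\<close> by (metis bitlen_le_iff_power nat_le_iff nat_0_le)
qed

lemma vsize_le_usize: "vsize v \<le> usize v"
proof (induction v)
  case (Num i)
  then show ?case using bitlen_le[of "\<bar>i\<bar>"] by simp
qed simp

lemma usize_pos: "usize v \<ge> 1"
  by (cases v) auto

lemma abs_int_of_le: "nat \<bar>int_of v\<bar> < usize v"
  by (cases v) auto

lemma usize_unop_val: "usize (unop_val f v) \<le> usize v + 1"
  by (cases v; cases f) auto

text \<open>For a positive divisor the quotient is monotone in the divisor, so divisor 1 is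
  extremal; a negative divisor is reduced to this case by negating both operands.\<close>

lemma abs_div_le: "\<bar>a div b\<bar> \<le> \<bar>a\<bar>" for a b :: int
proof -
  have *: "\<bar>a div b\<bar> \<le> \<bar>a\<bar>" if "b > 0" for a b :: int
  proof (cases "a \<ge> 0")
    case True
    then show ?thesis
      using zdiv_mono2[of a 1 b] that by (simp add: pos_imp_zdiv_nonneg_iff)
  next
    case False
    then show ?thesis
      using zdiv_mono2_neg[of a 1 b] neg_imp_zdiv_nonneg_iff[of b a] that
        div_neg_pos_less0[of a b] by simp
  qed
  show ?thesis
    using *[of b a] *[of "- b" "- a"] by (cases b "0 :: int" rule: linorder_cases) auto
qed

lemma abs_mod_le: "\<bar>a mod b\<bar> \<le> \<bar>a\<bar> + \<bar>b\<bar>" for a b :: int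
proof (cases "b = 0")
  case False
  then show ?thesis using abs_mod_less[of b a] by simp
qed simp

text \<open>Multiplication forces the square, since unary sizes multiply; for all other operations
  the size is essentially additive.\<close>

lemma usize_binop_val: "usize (binop_val f u v) \<le> (usize u + usize v + 1)\<^sup>2"
proof -
  let ?a = "int_of u" and ?b = "int_of v"
  have ab: "nat \<bar>?a\<bar> < usize u" "nat \<bar>?b\<bar> < usize v"
    by (rule abs_int_of_le)+
  have sq: "x \<le> usize u + usize v + 1 \<Longrightarrow> x \<le> (usize u + usize v + 1)\<^sup>2" for x
    by (simp add: power2_eq_square)
  have "nat \<bar>?a * ?b\<bar> \<le> (usize u - 1) * (usize v - 1)"
    unfolding abs_mult nat_mult_distrib[OF abs_ge_zero]
    using ab by (intro mult_le_mono) auto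
  also have "Suc \<dots> \<le> (usize u + usize v + 1)\<^sup>2"
    using mult_le_mono[of "usize u - 1" "usize u" "usize v - 1" "usize v"]
    by (simp add: power2_eq_square algebra_simps)
  finally show ?thesis
    using ab abs_div_le[of ?a ?b] abs_mod_le[of ?a ?b] abs_triangle_ineq[of ?a ?b]
      abs_triangle_ineq4[of ?a ?b]
    by (cases f) (auto intro!: sq[simplified] simp: nat_less_iff nat_le_iff)
qed

section \<open>Evaluation within a time budget\<close>

definition eval_within :: "(vname \<Rightarrow> val) \<Rightarrow> prog \<Rightarrow> val \<Rightarrow> nat \<Rightarrow> bool" where
  "eval_within \<rho> p v B \<longleftrightarrow> (\<exists>t \<le> B. eval \<rho> p v t)"

lemma within_mono: "eval_within \<rho> p v A \<Longrightarrow> A \<le> B \<Longrightarrow> eval_within \<rho> p v B"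
  unfolding eval_within_def by (meson order_trans)

lemma within_Var: "v = \<rho> x \<Longrightarrow> vsize v \<le> B \<Longrightarrow> eval_within \<rho> (Var x) v B"
  unfolding eval_within_def using eval_Var by blast

lemma within_Const: "vsize (Num i) \<le> B \<Longrightarrow> eval_within \<rho> (Const i) (Num i) B"
  unfolding eval_within_def using eval_Const by blast

text \<open>In this rule and the following ones the arithmetic is left as the last premise, so that
  intermediate costs can be rounded up to multiples of one bound on the loop state.\<close>

lemma within_Unary:
  "eval_within \<rho> p u A \<Longrightarrow> v = unop_val f u \<Longrightarrow> A + vsize v \<le> B \<Longrightarrow>
    eval_within \<rho> (Unary f p) v B"
  unfolding eval_within_def using eval_Unary by (meson add_le_mono1 order_trans)

lemma within_Binary:
  "eval_within \<rho> p u A \<Longrightarrow> eval_within \<rho> q w C \<Longrightarrow> v = binop_val f u w \<Longrightarrow>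
    A + C + vsize v \<le> B \<Longrightarrow> eval_within \<rho> (Binary f p q) v B"
  unfolding eval_within_def using eval_Binary by (meson add_le_mono add_le_mono1 order_trans)

lemma within_Cond:
  "eval_within \<rho> c b A \<Longrightarrow> eval_within \<rho> (if b \<noteq> Num 0 then p else q) v C \<Longrightarrow> A + C \<le> B \<Longrightarrow>
    eval_within \<rho> (Cond c p q) v B"
  unfolding eval_within_def using eval_Cond by (meson add_le_mono order_trans)

lemma within_LetIn:
  "eval_within \<rho> p u A \<Longrightarrow> eval_within (\<rho>(x := u)) q v C \<Longrightarrow> A + C \<le> B \<Longrightarrow>
    eval_within \<rho> (LetIn x p q) v B"
  unfolding eval_within_def using eval_LetIn by (meson add_le_mono order_trans)

text \<open>\<open>st k\<close> is the state before round \<open>k\<close>. A round pays for a test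
  and a body, the exit for a test and for reading the variable, hence \<open>2 * B\<close> for each
  of \<open>Suc K\<close> items.\<close>

lemma within_While:
  assumes "\<And>k. k < K \<Longrightarrow> \<exists>b. b \<noteq> Num 0 \<and> eval_within (\<rho>(x := st k)) c b B"
    and "\<And>k. k < K \<Longrightarrow> eval_within (\<rho>(x := st k)) p (st (Suc k)) B"
    and "eval_within (\<rho>(x := st K)) c (Num 0) B"
    and "vsize (st K) \<le> B"
  shows "eval_within (\<rho>(x := st 0)) (While x c p) (st K) (2 * B * Suc K)"
proof -
  \<comment> \<open>The induction descends from \<open>K\<close>, since the time recorded by the
    semantics is that of the rounds still to come.\<close>
  have "eval_within (\<rho>(x := st k)) (While x c p) (st K) (2 * B * Suc (K - k))" if "k \<le> K" for k
    using that
  proof (induction k rule: inc_induct)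
    case base
    from assms(3) obtain t where t: "t \<le> B" "eval (\<rho>(x := st K)) c (Num 0) t"
      by (auto simp: eval_within_def)
    show ?case
      using eval_While_stop[OF t(2), of x p, unfolded fun_upd_same] t(1) assms(4)
      by (auto simp: eval_within_def simp del: fun_upd_apply intro!: exI[of _ "t + vsize (st K)"])
  next
    case (step k)
    obtain b r where b: "b \<noteq> Num 0" "r \<le> B" "eval (\<rho>(x := st k)) c b r"
      using assms(1)[OF step.hyps(2)] by (auto simp: eval_within_def)
    obtain s where s: "s \<le> B" "eval (\<rho>(x := st k)) p (st (Suc k)) s"
      using assms(2)[OF step.hyps(2)] by (auto simp: eval_within_def)
    obtain t where t: "t \<le> 2 * B * Suc (K - Suc k)"
        "eval (\<rho>(x := st k, x := st (Suc k))) (While x c p) (st K) t"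
      using step.IH unfolding eval_within_def fun_upd_upd by blast
    have "r + s + t \<le> 2 * B * Suc (K - k)"
      using b(2) s(1) t(1) step.hyps(2) by (simp add: Suc_diff_Suc[symmetric])
    with eval_While_step[OF b(3,1) s(2) t(2)] show ?case
      unfolding eval_within_def by blast
  qed
  from this[of 0] show ?thesis by simp
qed

section \<open>Correctness and cost of compiled expressions\<close>

lemma bitlen_one [simp]: "bitlen 1 = 1"
  by (simp add: bitlen_alt_def)

lemma spine_le_usize: "spine v < usize v"
  by (induction v rule: spine.induct) auto

lemma usize_Tail_le: "usize (unop_val Tail v) \<le> usize v"
  by (cases v) auto

lemma usize_Tail_power_le: "usize ((unop_val Tail ^^ k) v) \<le> usize v"
  by (induction k) (auto intro: order_trans[OF usize_Tail_le])

lemma spine_Tail: "spine (unop_val Tail v) = spine v - 1"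
  by (cases v) auto

lemma spine_Tail_power: "spine ((unop_val Tail ^^ k) v) = spine v - k"
  by (induction k) (auto simp: spine_Tail)

lemma IsNode_spine: "unop_val IsNode v = truth (spine v > 0)"
  by (cases v) auto

lemma usize_foldr_Node_le:
  assumes "\<And>j. j \<in> set js \<Longrightarrow> usize (f j) \<le> Q"
  shows "usize (foldr (\<lambda>j acc. if P j then Node (f j) acc else acc) js v)
    \<le> usize v + length js * Suc Q"
  using assms
proof (induction js)
  case (Cons j js)
  then show ?case by (fastforce simp: add_mono)
qed simp

text \<open>The common frame of the three compiled loops: build the initial pair, iterate, project.
  Building costs \<open>2 * Z\<close> and projecting \<open>Z\<close>, the last summand of
  \<open>loop_bound\<close>.\<close>

lemma within_loop_result:
  assumes "eval_within \<rho> p u A" and "eval_within \<rho> q w C"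
    and "eval_within (\<rho>(x := Node u w)) l v (2 * (12 * Z + 10) * Suc N)"
    and "A + C + vsize (Node u w) \<le> 2 * Z" and "vsize (unop_val f v) \<le> Z"
  shows "eval_within \<rho> (LetIn x (Binary MkNode p q) (Unary f l)) (unop_val f v) (loop_bound N Z)"
proof -
  have "eval_within \<rho> (Binary MkNode p q) (Node u w) (2 * Z)"
    using assms(4) by (intro within_Binary[OF assms(1,2)]) auto
  moreover have "eval_within (\<rho>(x := Node u w)) (Unary f l) (unop_val f v) (2 * (12 * Z + 10) * Suc N + Z)"
    using assms(5) by (intro within_Unary[OF assms(3)]) auto
  ultimately show ?thesis
    by (rule within_LetIn) (simp add: loop_bound_def)
qed

lemma within_Head_Var:
  "\<rho> x = Node u v \<Longrightarrow> vsize u + vsize v + 1 \<le> Z \<Longrightarrow> eval_within \<rho> (Unary Head (Var x)) u (2 * Z)"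
  by (rule within_Unary[where u = "Node u v" and A = Z], rule within_Var) auto

lemma within_Tail_Var:
  "\<rho> x = Node u v \<Longrightarrow> vsize u + vsize v + 1 \<le> Z \<Longrightarrow> eval_within \<rho> (Unary Tail (Var x)) v (2 * Z)"
  by (rule within_Unary[where u = "Node u v" and A = Z], rule within_Var) auto

text \<open>Time and size are proved together because the time of a construct depends on the sizes
  of the values inside it. Only the prefixed variables of the machine environment \<rho> are
  constrained, so the hypothesis still applies inside a loop that has overwritten
  \<open>s\<close>.\<close>

theorem compile_correct:
  assumes "\<And>x. \<rho> (cvar x) = \<sigma> x" and "\<And>x. usize (\<sigma> x) \<le> s"
  shows "eval_within \<rho> (compile e) (den e \<sigma>) (bound e s) \<and> usize (den e \<sigma>) \<le> bound e s"
  using assms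
proof (induction e arbitrary: \<sigma> \<rho> s)
  case (BVar x)
  then show ?case
    by (auto intro!: within_Var intro: order_trans[OF vsize_le_usize])
next
  case (BConst i)
  then show ?case
    using within_Const[of i "usize (Num i)" \<rho>] vsize_le_usize[of "Num i"] by simp
next
  case (BUnary f p)
  let ?u = "den p \<sigma>"
  have p: "eval_within \<rho> (compile p) ?u (bound p s)" "usize ?u \<le> bound p s"
    using BUnary.IH[of \<rho> \<sigma> s, OF BUnary.prems] by auto
  have u: "usize (unop_val f ?u) \<le> bound p s + 1"
    using usize_unop_val[of f ?u] p(2) by simp
  have "eval_within \<rho> (Unary f (compile p)) (unop_val f ?u) (2 * bound p s + 1)"
    using vsize_le_usize[of "unop_val f ?u"] u by (intro within_Unary[OF p(1)]) auto
  with u show ?case by simp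
next
  case (BBinary f p q)
  let ?u = "den p \<sigma>" and ?v = "den q \<sigma>"
  have p: "eval_within \<rho> (compile p) ?u (bound p s)" "usize ?u \<le> bound p s"
    using BBinary.IH(1)[of \<rho> \<sigma> s, OF BBinary.prems] by auto
  have q: "eval_within \<rho> (compile q) ?v (bound q s)" "usize ?v \<le> bound q s"
    using BBinary.IH(2)[of \<rho> \<sigma> s, OF BBinary.prems] by auto
  have u: "usize (binop_val f ?u ?v) \<le> (bound p s + bound q s + 1)\<^sup>2"
    using usize_binop_val[of f ?u ?v] p(2) q(2)
    by (meson add_le_mono le_refl order_trans power_mono zero_le)
  have "eval_within \<rho> (Binary f (compile p) (compile q)) (binop_val f ?u ?v) (bound (BBinary f p q) s)"
    using vsize_le_usize[of "binop_val f ?u ?v"] u by (intro within_Binary[OF p(1) q(1)]) auto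
  with u show ?case by simp
next
  case (BCond c p q)
  have c: "eval_within \<rho> (compile c) (den c \<sigma>) (bound c s)"
    using BCond.IH(1)[of \<rho> \<sigma> s, OF BCond.prems] by auto
  have "eval_within \<rho> (if den c \<sigma> \<noteq> Num 0 then compile p else compile q)
      (den (BCond c p q) \<sigma>) (bound p s + bound q s)"
    using BCond.IH(2,3)[of \<rho> \<sigma> s, OF BCond.prems] by (auto elim: within_mono)
  then have "eval_within \<rho> (compile (BCond c p q)) (den (BCond c p q) \<sigma>) (bound (BCond c p q) s)"
    unfolding compile.simps by (rule within_Cond[OF c]) simp
  moreover have "usize (den (BCond c p q) \<sigma>) \<le> bound (BCond c p q) s"
    using BCond.IH(2,3)[of \<rho> \<sigma> s, OF BCond.prems] by auto
  ultimately show ?case by blast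
next
  case (BLet x p q)
  let ?u = "den p \<sigma>"
  have p: "eval_within \<rho> (compile p) ?u (bound p s)" "usize ?u \<le> bound p s"
    using BLet.IH(1)[of \<rho> \<sigma> s, OF BLet.prems] by auto
  have "eval_within (\<rho>(cvar x := ?u)) (compile q) (den q (\<sigma>(x := ?u))) (bound q (s + bound p s)) \<and>
      usize (den q (\<sigma>(x := ?u))) \<le> bound q (s + bound p s)"
    using p(2) BLet.prems by (intro BLet.IH(2)) (auto intro: trans_le_add1)
  then show ?case
    using within_LetIn[OF p(1), of "cvar x" "compile q"] by auto
next
  case (BDrop k l)
  let ?u = "den k \<sigma>" and ?v = "den l \<sigma>"
  have k: "eval_within \<rho> (compile k) ?u (bound k s)" "usize ?u \<le> bound k s"
    using BDrop.IH(1)[of \<rho> \<sigma> s, OF BDrop.prems] by auto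
  have l: "eval_within \<rho> (compile l) ?v (bound l s)" "usize ?v \<le> bound l s"
    using BDrop.IH(2)[of \<rho> \<sigma> s, OF BDrop.prems] by auto
  define K where "K = nat (int_of ?u)"
  define Z where "Z = bound k s + bound l s + 2"
  \<comment> \<open>The first counter is the value of \<open>k\<close> itself, which may be negative
    or even a \<open>Node\<close>; in both cases \<open>K\<close> is 0 and the loop stops at once.
    Only after a decrement is the counter known to be a \<open>Num\<close>.\<close>
  define h where "h i = (if i = 0 then ?u else Num (int K - int i))" for i :: nat
  define tl where "tl i = (unop_val Tail ^^ i) ?v" for i
  define st where "st i = Node (h i) (tl i)" for i
  have h: "int_of (h i) > 0 \<longleftrightarrow> i < K" if "i \<le> K" for i
    using that by (auto simp: h_def K_def)
  have h_Suc: "Num (int_of (h i) - 1) = h (Suc i)" if "i < K" for i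
    using that by (auto simp: h_def K_def)
  have K: "K < bound k s"
    using abs_int_of_le[of ?u] k(2) by (simp add: K_def)
  have "usize (h i) \<le> bound k s" if "i \<le> K" for i
    using that K k(2) by (auto simp: h_def)
  then have st_Z: "vsize (h i) + vsize (tl i) + 1 \<le> Z" if "i \<le> K" for i
    using that usize_Tail_power_le[of i ?v] l(2)
      vsize_le_usize[of "h i"] vsize_le_usize[of "tl i"]
    unfolding Z_def tl_def by fastforce
  let ?c = "Binary Less (Const 0) (Unary Head (Var ''s''))"
  let ?p = "Binary MkNode (Binary Minus (Unary Head (Var ''s'')) (Const 1))
      (Unary Tail (Unary Tail (Var ''s'')))"
  have c: "eval_within (\<rho>(''s'' := st i)) ?c (truth (i < K)) (12 * Z + 10)"
    if "i \<le> K" for i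
    using st_Z[OF that] h[OF that]
    by (intro within_Binary[OF within_Const[of 0 1] within_Head_Var[of _ _ "h i" "tl i" Z]])
      (auto simp: st_def)
  have p: "eval_within (\<rho>(''s'' := st i)) ?p (st (Suc i)) (12 * Z + 10)" if "i < K" for i
  proof -
    have "eval_within (\<rho>(''s'' := st i)) (Binary Minus (Unary Head (Var ''s'')) (Const 1))
        (h (Suc i)) (3 * Z + 2)"
      using st_Z[of i] st_Z[of "Suc i"] that h_Suc[OF that]
      by (intro within_Binary[OF within_Head_Var[of _ _ "h i" "tl i" Z] within_Const[of 1 2]])
        (auto simp: st_def)
    moreover have "eval_within (\<rho>(''s'' := st i)) (Unary Tail (Unary Tail (Var ''s'')))
        (tl (Suc i)) (3 * Z)"
      using st_Z[of i] st_Z[of "Suc i"] that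
      by (intro within_Unary[OF within_Tail_Var[of _ _ "h i" "tl i" Z]])
        (auto simp: st_def tl_def)
    ultimately show ?thesis
      by (rule within_Binary) (use st_Z[of "Suc i"] that in \<open>auto simp: st_def\<close>)
  qed
  have st0: "st 0 = Node ?u ?v"
    by (simp add: st_def h_def tl_def)
  have loop: "eval_within (\<rho>(''s'' := st 0)) (While ''s'' ?c ?p) (st K) (2 * (12 * Z + 10) * Suc K)"
  proof (rule within_While)
    show "\<exists>b. b \<noteq> Num 0 \<and> eval_within (\<rho>(''s'' := st i)) ?c b (12 * Z + 10)" if "i < K" for i
      using c[of i] that by (intro exI[of _ "Num 1"]) simp
    show "eval_within (\<rho>(''s'' := st K)) ?c (Num 0) (12 * Z + 10)"
      using c[of K] by simp
    show "vsize (st K) \<le> 12 * Z + 10"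
      using st_Z[of K] by (simp add: st_def)
  qed (rule p)
  have "eval_within \<rho> (compile (BDrop k l)) (unop_val Tail (st K)) (loop_bound (bound k s) Z)"
    unfolding compile.simps
  proof (rule within_loop_result[OF k(1) l(1)])
    show "eval_within (\<rho>(''s'' := Node ?u ?v)) (While ''s'' ?c ?p) (st K)
        (2 * (12 * Z + 10) * Suc (bound k s))"
      by (rule within_mono[OF loop[unfolded st0]]) (use K in simp)
    show "bound k s + bound l s + vsize (Node ?u ?v) \<le> 2 * Z"
      using st_Z[of 0] by (simp add: h_def tl_def Z_def)
    show "vsize (unop_val Tail (st K)) \<le> Z"
      using st_Z[of K] by (simp add: st_def)
  qed
  moreover have "usize (tl K) \<le> loop_bound (bound k s) Z"
    using usize_Tail_power_le[of K ?v] l(2) by (simp add: tl_def Z_def loop_bound_def)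
  ultimately show ?case
    by (simp add: st_def tl_def K_def Z_def)
next
  case (BLen l)
  let ?v = "den l \<sigma>"
  have l: "eval_within \<rho> (compile l) ?v (bound l s)" "usize ?v \<le> bound l s"
    using BLen.IH[of \<rho> \<sigma> s, OF BLen.prems] by auto
  define K where "K = spine ?v"
  define Z where "Z = 2 * bound l s + 4"
  define tl where "tl i = (unop_val Tail ^^ i) ?v" for i
  define st where "st i = Node (Num (int i)) (tl i)" for i
  have spine_tl: "spine (tl i) = K - i" for i
    by (simp add: tl_def spine_Tail_power K_def)
  have K: "K < bound l s"
    using spine_le_usize[of ?v] l(2) by (simp add: K_def)
  have st_Z: "vsize (Num (int i)) + vsize (tl i) + 1 \<le> Z" if "i \<le> K" for i
  proof -
    have "usize (Num (int i)) \<le> bound l s"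
      using that K by simp
    moreover have "usize (tl i) \<le> bound l s"
      using usize_Tail_power_le[of i ?v] l(2) by (simp add: tl_def)
    ultimately show ?thesis
      using vsize_le_usize[of "Num (int i)"] vsize_le_usize[of "tl i"] unfolding Z_def by linarith
  qed
  let ?c = "Unary IsNode (Unary Tail (Var ''s''))"
  let ?p = "Binary MkNode (Binary Plus (Unary Head (Var ''s'')) (Const 1))
      (Unary Tail (Unary Tail (Var ''s'')))"
  have c: "eval_within (\<rho>(''s'' := st i)) ?c (truth (i < K)) (12 * Z + 10)"
    if "i \<le> K" for i
    using st_Z[OF that] spine_tl[of i]
    by (intro within_Unary[OF within_Tail_Var[of _ _ "Num (int i)" "tl i" Z]])
      (auto simp: st_def IsNode_spine)
  have p: "eval_within (\<rho>(''s'' := st i)) ?p (st (Suc i)) (12 * Z + 10)" if "i < K" for i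
  proof -
    have "eval_within (\<rho>(''s'' := st i)) (Binary Plus (Unary Head (Var ''s'')) (Const 1))
        (Num (int (Suc i))) (3 * Z + 2)"
      using st_Z[of i] st_Z[of "Suc i"] that
      by (intro within_Binary[OF within_Head_Var[of _ _ "Num (int i)" "tl i" Z] within_Const[of 1 2]])
        (auto simp: st_def algebra_simps)
    moreover have "eval_within (\<rho>(''s'' := st i)) (Unary Tail (Unary Tail (Var ''s'')))
        (tl (Suc i)) (3 * Z)"
      using st_Z[of i] st_Z[of "Suc i"] that
      by (intro within_Unary[OF within_Tail_Var[of _ _ "Num (int i)" "tl i" Z]])
        (auto simp: st_def tl_def)
    ultimately show ?thesis
      by (rule within_Binary) (use st_Z[of "Suc i"] that in \<open>auto simp: st_def\<close>)
  qed
  have st0: "st 0 = Node (Num 0) ?v"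
    by (simp add: st_def tl_def)
  have loop: "eval_within (\<rho>(''s'' := st 0)) (While ''s'' ?c ?p) (st K) (2 * (12 * Z + 10) * Suc K)"
  proof (rule within_While)
    show "\<exists>b. b \<noteq> Num 0 \<and> eval_within (\<rho>(''s'' := st i)) ?c b (12 * Z + 10)" if "i < K" for i
      using c[of i] that by (intro exI[of _ "Num 1"]) simp
    show "eval_within (\<rho>(''s'' := st K)) ?c (Num 0) (12 * Z + 10)"
      using c[of K] by simp
    show "vsize (st K) \<le> 12 * Z + 10"
      using st_Z[of K] by (simp add: st_def)
  qed (rule p)
  have "eval_within \<rho> (compile (BLen l)) (unop_val Head (st K)) (loop_bound (bound l s) Z)"
    unfolding compile.simps
  proof (rule within_loop_result[OF within_Const[of 0 1] l(1)])
    show "eval_within (\<rho>(''s'' := Node (Num 0) ?v)) (While ''s'' ?c ?p) (st K)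
        (2 * (12 * Z + 10) * Suc (bound l s))"
      by (rule within_mono[OF loop[unfolded st0]]) (use K in simp)
    show "1 + bound l s + vsize (Node (Num 0) ?v) \<le> 2 * Z"
      using st_Z[of 0] by (simp add: tl_def Z_def)
    show "vsize (unop_val Head (st K)) \<le> Z"
      using st_Z[of K] by (simp add: st_def)
  qed simp
  moreover have "usize (Num (int K)) \<le> loop_bound (bound l s) Z"
    using K by (simp add: Z_def loop_bound_def)
  ultimately show ?case
    by (simp add: st_def K_def Z_def)
next
  case (BTab i n c p r)
  let ?u = "den n \<sigma>" and ?r = "den r \<sigma>" and ?\<sigma> = "\<lambda>j. \<sigma>(i := Num (int j))"
  define N where "N = bound n s"
  define Q where "Q = bound c (s + N) + bound p (s + N)"
  define Z where "Z = N + bound r s + Suc N * Suc Q + 2"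
  define K where "K = nat (int_of ?u)"
  have n: "eval_within \<rho> (compile n) ?u N" "usize ?u \<le> N"
    using BTab.IH(1)[of \<rho> \<sigma> s, OF BTab.prems] by (auto simp: N_def)
  have r: "eval_within \<rho> (compile r) ?r (bound r s)" "usize ?r \<le> bound r s"
    using BTab.IH(4)[of \<rho> \<sigma> s, OF BTab.prems] by auto
  have K: "K < N"
    using abs_int_of_le[of ?u] n(2) by (simp add: K_def)
  have env: "usize (?\<sigma> j x) \<le> s + N" if "j < K" for j x
    using that K BTab.prems(2)[of x] by auto
  have c: "eval_within \<rho>' (compile c) (den c (?\<sigma> j)) Q"
    if "j < K" "\<And>x. \<rho>' (cvar x) = ?\<sigma> j x" for j \<rho>'
    by (rule within_mono[OF conjunct1[OF BTab.IH(2)[of \<rho>' "?\<sigma> j" "s + N", OF that(2) env[OF that(1)]]]]) (simp add: Q_def)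
  have p: "eval_within \<rho>' (compile p) (den p (?\<sigma> j)) Q"
    if "j < K" "\<And>x. \<rho>' (cvar x) = ?\<sigma> j x" for j \<rho>'
    by (rule within_mono[OF conjunct1[OF BTab.IH(3)[of \<rho>' "?\<sigma> j" "s + N", OF that(2) env[OF that(1)]]]]) (simp add: Q_def)
  \<comment> \<open>The induction hypothesis asks for a machine environment even where only the size
    is wanted; stripping the prefix of the variable name with \<open>tl\<close> provides
    one.\<close>
  have pu: "usize (den p (?\<sigma> j)) \<le> Q" if "j < K" for j
    by (rule order_trans[OF conjunct2[OF BTab.IH(3)[of "\<lambda>x. ?\<sigma> j (tl x)" "?\<sigma> j" "s + N", OF _ env[OF that]]]])
      (simp_all add: Q_def)
  define f where "f j acc = (if den c (?\<sigma> j) \<noteq> Num 0 then Node (den p (?\<sigma> j)) acc else acc)" for j acc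
  define h where "h k = (if k = 0 then ?u else Num (int K - int k))" for k :: nat
  \<comment> \<open>After \<open>k\<close> rounds the entries of the last \<open>k\<close> indices
    are in place, in front of the tail.\<close>
  define A where "A k = foldr f [K - k..<K] ?r" for k
  define st where "st k = Node (h k) (A k)" for k
  have h: "int_of (h k) > 0 \<longleftrightarrow> k < K" if "k \<le> K" for k
    using that by (auto simp: h_def K_def)
  have h_Suc: "int_of (h k) - 1 = int (K - Suc k)" "h (Suc k) = Num (int (K - Suc k))" if "k < K" for k
    using that by (auto simp: h_def K_def)
  have A_Suc: "A (Suc k) = f (K - Suc k) (A k)" if "k < K" for k
    using that by (simp add: A_def upt_conv_Cons Suc_diff_Suc)
  have usize_A: "usize (A k) \<le> bound r s + N * Suc Q" if "k \<le> K" for k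
  proof -
    have "usize (A k) \<le> usize ?r + length [K - k..<K] * Suc Q"
      unfolding A_def f_def by (rule usize_foldr_Node_le) (use pu in auto)
    also have "\<dots> \<le> bound r s + N * Suc Q"
      using r(2) that K by (intro add_mono mult_right_mono) auto
    finally show ?thesis .
  qed
  have "usize (h k) \<le> N" if "k \<le> K" for k
    using that K n(2) by (auto simp: h_def)
  then have st_Z: "vsize (h k) + vsize (A k) + 1 \<le> Z" if "k \<le> K" for k
    using that usize_A[OF that] vsize_le_usize[of "h k"] vsize_le_usize[of "A k"]
    unfolding Z_def by fastforce
  have Q_Z: "Q < Z"
    by (simp add: Z_def)
  let ?c = "Binary Less (Const 0) (Unary Head (Var ''s''))"
  let ?q = "Binary MkNode (Var (cvar i))
      (Cond (compile c) (Binary MkNode (compile p) (Unary Tail (Var ''s'')))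
        (Unary Tail (Var ''s'')))"
  let ?p = "LetIn (cvar i) (Binary Minus (Unary Head (Var ''s'')) (Const 1)) ?q"
  have loop_c: "eval_within (\<rho>(''s'' := st k)) ?c (truth (k < K)) (12 * Z + 10)"
    if "k \<le> K" for k
    using st_Z[OF that] h[OF that]
    by (intro within_Binary[OF within_Const[of 0 1] within_Head_Var[of _ _ "h k" "A k" Z]])
      (auto simp: st_def)
  have loop_p: "eval_within (\<rho>(''s'' := st k)) ?p (st (Suc k)) (12 * Z + 10)" if "k < K" for k
  proof -
    define j where "j = K - Suc k"
    have j: "j < K" using that by (simp add: j_def)
    have hj: "h (Suc k) = Num (int j)" "int_of (h k) - 1 = int j"
      using h_Suc[OF that] by (simp_all add: j_def)
    have AZ: "A (Suc k) = f j (A k)" "vsize (A (Suc k)) < Z" "vsize (A k) < Z" "vsize (Num (int j)) < Z"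
      using A_Suc[OF that] st_Z[of "Suc k"] st_Z[of k] that by (auto simp: j_def h_Suc)
    let ?\<rho> = "\<rho>(''s'' := st k, cvar i := Num (int j))"
    have \<rho>: "?\<rho> (cvar x) = ?\<sigma> j x" for x
      using BTab.prems(1)[of x] by simp
    have tail: "eval_within ?\<rho> (Unary Tail (Var ''s'')) (A k) (2 * Z)"
      using st_Z[of k] that by (intro within_Tail_Var) (auto simp: st_def)
    have "eval_within ?\<rho> (if den c (?\<sigma> j) \<noteq> Num 0 then Binary MkNode (compile p) (Unary Tail (Var ''s''))
        else Unary Tail (Var ''s'')) (A (Suc k)) (Q + 3 * Z)"
    proof (cases "den c (?\<sigma> j) \<noteq> Num 0")
      case True
      then have "eval_within ?\<rho> (Binary MkNode (compile p) (Unary Tail (Var ''s''))) (A (Suc k)) (Q + 3 * Z)"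
        using AZ by (intro within_Binary[OF p[OF j \<rho>] tail]) (auto simp: f_def)
      with True show ?thesis by simp
    next
      case False
      then show ?thesis
        using tail AZ(1) by (auto simp: f_def elim: within_mono)
    qed
    then have cond: "eval_within ?\<rho> (Cond (compile c) (Binary MkNode (compile p) (Unary Tail (Var ''s'')))
        (Unary Tail (Var ''s''))) (A (Suc k)) (2 * Q + 3 * Z)"
      by (rule within_Cond[OF c[OF j \<rho>]]) simp
    have var: "eval_within ?\<rho> (Var (cvar i)) (Num (int j)) Z"
      using AZ(4) by (intro within_Var) auto
    have q: "eval_within ?\<rho> ?q (st (Suc k)) (2 * Q + 5 * Z)"
      using st_Z[of "Suc k"] that by (intro within_Binary[OF var cond]) (auto simp: st_def hj)
    have "eval_within (\<rho>(''s'' := st k)) (Binary Minus (Unary Head (Var ''s'')) (Const 1))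
        (Num (int j)) (3 * Z + 2)"
      using st_Z[of k] AZ(4) that
      by (intro within_Binary[OF within_Head_Var[of _ _ "h k" "A k" Z] within_Const[of 1 2]])
        (auto simp: st_def hj)
    then show ?thesis
      using q by (rule within_LetIn) (use Q_Z in simp)
  qed
  have st0: "st 0 = Node ?u ?r"
    by (simp add: st_def h_def A_def)
  have loop: "eval_within (\<rho>(''s'' := st 0)) (While ''s'' ?c ?p) (st K) (2 * (12 * Z + 10) * Suc K)"
  proof (rule within_While)
    show "\<exists>b. b \<noteq> Num 0 \<and> eval_within (\<rho>(''s'' := st k)) ?c b (12 * Z + 10)" if "k < K" for k
      using loop_c[of k] that by (intro exI[of _ "Num 1"]) simp
    show "eval_within (\<rho>(''s'' := st K)) ?c (Num 0) (12 * Z + 10)"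
      using loop_c[of K] by simp
    show "vsize (st K) \<le> 12 * Z + 10"
      using st_Z[of K] by (simp add: st_def)
  qed (rule loop_p)
  have "eval_within \<rho> (compile (BTab i n c p r)) (unop_val Tail (st K)) (loop_bound N Z)"
    unfolding compile.simps
  proof (rule within_loop_result[OF n(1) r(1)])
    show "eval_within (\<rho>(''s'' := Node ?u ?r)) (While ''s'' ?c ?p) (st K)
        (2 * (12 * Z + 10) * Suc N)"
      by (rule within_mono[OF loop[unfolded st0]]) (use K in simp)
    show "N + bound r s + vsize (Node ?u ?r) \<le> 2 * Z"
      using st_Z[of 0] by (simp add: h_def A_def Z_def)
    show "vsize (unop_val Tail (st K)) \<le> Z"
      using st_Z[of K] by (simp add: st_def)
  qed
  moreover have "den (BTab i n c p r) \<sigma> = A K"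
    by (simp add: A_def f_def[abs_def] K_def)
  moreover have "usize (A K) \<le> loop_bound N Z"
    using usize_A[of K] by (simp add: Z_def loop_bound_def)
  moreover have "bound (BTab i n c p r) s = loop_bound N Z"
    by (simp add: N_def Q_def Z_def Let_def)
  ultimately show ?case
    by (simp add: st_def)
qed

section \<open>Polynomially bounded functions\<close>

definition poly_bounded :: "(nat \<Rightarrow> nat) \<Rightarrow> bool" where
  "poly_bounded f \<longleftrightarrow> (\<exists>b. \<forall>s. f s \<le> (s + 2) ^ b)"

lemma poly_bounded_mono: "poly_bounded g \<Longrightarrow> (\<And>s. f s \<le> g s) \<Longrightarrow> poly_bounded f"
  unfolding poly_bounded_def by (meson order_trans)

lemma poly_bounded_id: "poly_bounded (\<lambda>s. s)"
  unfolding poly_bounded_def by (intro exI[of _ 1]) simp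

text \<open>The base \<open>s + 2\<close> is at least 2, so any coefficient is absorbed into the
  exponent; a bound is therefore a single power.\<close>

lemma poly_bounded_const: "poly_bounded (\<lambda>s. c)"
proof -
  have "c \<le> (s + 2) ^ c" for s
    using power_mono[of 2 "s + 2" c] less_exp[of c] by linarith
  then show ?thesis unfolding poly_bounded_def by blast
qed

lemma poly_bounded_mult:
  assumes "poly_bounded f" "poly_bounded g"
  shows "poly_bounded (\<lambda>s. f s * g s)"
proof -
  obtain b c where "\<And>s. f s \<le> (s + 2) ^ b" "\<And>s. g s \<le> (s + 2) ^ c"
    using assms unfolding poly_bounded_def by blast
  then have "f s * g s \<le> (s + 2) ^ (b + c)" for s
    unfolding power_add by (intro mult_le_mono)
  then show ?thesis unfolding poly_bounded_def by blast
qed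

text \<open>A sum is dominated by \<open>(f s + 1) * (g s + 1)\<close>, which reduces addition to
  multiplication.\<close>

lemma poly_bounded_add:
  assumes "poly_bounded f" "poly_bounded g"
  shows "poly_bounded (\<lambda>s. f s + g s)"
proof (rule poly_bounded_mono)
  show "poly_bounded (\<lambda>s. (f s + 1) * (g s + 1))"
  proof (rule poly_bounded_mult)
    have *: "poly_bounded (\<lambda>s. f s + 1)" if f: "poly_bounded f" for f
    proof -
      obtain b where b: "\<And>s. f s \<le> (s + 2) ^ b"
        using f unfolding poly_bounded_def by blast
      have "f s + 1 \<le> (s + 2) ^ Suc b" for s
      proof -
        have "1 \<le> (s + 2) ^ b" by simp
        then have "f s + 1 \<le> 2 * (s + 2) ^ b" using b[of s] by linarith
        also have "\<dots> \<le> (s + 2) ^ Suc b" by simp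
        finally show ?thesis .
      qed
      then show ?thesis unfolding poly_bounded_def by blast
    qed
    show "poly_bounded (\<lambda>s. f s + 1)" "poly_bounded (\<lambda>s. g s + 1)"
      by (rule *; fact)+
  qed
qed simp

lemma poly_bounded_compose:
  assumes "poly_bounded f" "poly_bounded g"
  shows "poly_bounded (\<lambda>s. f (g s))"
proof -
  obtain b where b: "\<And>s. f s \<le> (s + 2) ^ b"
    using assms(1) unfolding poly_bounded_def by blast
  obtain c where c: "\<And>s. g s + 2 \<le> (s + 2) ^ c"
    using poly_bounded_add[OF assms(2) poly_bounded_const[of 2]] unfolding poly_bounded_def by blast
  have "f (g s) \<le> (s + 2) ^ (c * b)" for s
    using b[of "g s"] power_mono[OF c[of s], of b] by (simp add: power_mult)
  then show ?thesis unfolding poly_bounded_def by blast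
qed

lemma poly_bounded_loop_bound:
  assumes "poly_bounded f" "poly_bounded g"
  shows "poly_bounded (\<lambda>s. loop_bound (f s) (g s))"
  unfolding loop_bound_def Suc_eq_plus1
  by (intro poly_bounded_add poly_bounded_mult poly_bounded_const assms)

lemma poly_bounded_bound: "poly_bounded (bound e)"
proof (induction e)
  case (BVar x)
  show ?case unfolding bound.simps by (rule poly_bounded_id)
next
  case (BConst i)
  show ?case unfolding bound.simps by (rule poly_bounded_const)
next
  case (BUnary f p)
  show ?case unfolding bound.simps
    by (intro poly_bounded_add poly_bounded_mult poly_bounded_const BUnary)
next
  case (BBinary f p q)
  show ?case unfolding bound.simps power2_eq_square
    by (intro poly_bounded_add poly_bounded_mult poly_bounded_const BBinary)
next
  case (BCond c p q)
  show ?case unfolding bound.simps by (intro poly_bounded_add BCond)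
next
  case (BLet x p q)
  show ?case unfolding bound.simps
    by (intro poly_bounded_add BLet poly_bounded_id
        poly_bounded_compose[of "bound q" "\<lambda>s. s + bound p s"])
next
  case (BDrop k l)
  show ?case unfolding bound.simps
    by (intro poly_bounded_loop_bound poly_bounded_add poly_bounded_const BDrop)
next
  case (BLen l)
  show ?case unfolding bound.simps
    by (intro poly_bounded_loop_bound poly_bounded_add poly_bounded_mult poly_bounded_const BLen)
next
  case (BTab i n c p r)
  show ?case unfolding bound.simps Let_def Suc_eq_plus1
    by (intro poly_bounded_loop_bound poly_bounded_add poly_bounded_mult poly_bounded_const
        poly_bounded_id BTab poly_bounded_compose[of "bound c" "\<lambda>s. s + bound n s"]
        poly_bounded_compose[of "bound p" "\<lambda>s. s + bound n s"])
qed

text \<open>The argument arrives under the unprefixed name \<open>input\<close>, which compiled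
  expressions cannot mention, and is copied once.\<close>

definition program :: "bexp \<Rightarrow> prog" where
  "program e = LetIn (cvar ''in'') (Var ''input'') (compile e)"

definition input_env :: "val \<Rightarrow> string \<Rightarrow> val" where
  "input_env v = (\<lambda>_. Num 0)(''in'' := v)"

text \<open>The size of the result is bounded along with the time because the output of the
  reduction becomes the input of the program that finds a feasible solution.\<close>

theorem runs_poly_time:
  obtains b where "\<And>v. \<exists>t. runs (program e) v (den e (input_env v)) t \<and>
      t \<le> (usize v + 2) ^ b"
    and "\<And>v. usize (den e (input_env v)) \<le> (usize v + 2) ^ b"
proof -
  have "poly_bounded (\<lambda>s. s + bound e s)"
    by (intro poly_bounded_add poly_bounded_id poly_bounded_bound)
  then obtain b where b: "\<And>s. s + bound e s \<le> (s + 2) ^ b"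
    unfolding poly_bounded_def by blast
  have *: "eval_within ((\<lambda>_. Num 0)(''input'' := v)) (program e)
        (den e (input_env v)) (usize v + bound e (usize v)) \<and>
      usize (den e (input_env v)) \<le> bound e (usize v)" for v
  proof -
    let ?\<rho> = "(\<lambda>_. Num 0)(''input'' := v)"
    have "eval_within (?\<rho>(cvar ''in'' := v)) (compile e) (den e (input_env v)) (bound e (usize v)) \<and>
        usize (den e (input_env v)) \<le> bound e (usize v)"
      by (rule compile_correct) (auto simp: input_env_def Suc_le_eq usize_pos[unfolded One_nat_def Suc_le_eq])
    moreover have "eval_within ?\<rho> (Var ''input'') v (usize v)"
      by (rule within_Var) (simp_all add: vsize_le_usize)
    ultimately show ?thesis
      by (auto simp: program_def intro: within_LetIn simp del: fun_upd_apply)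
  qed
  show thesis
  proof (rule that[of b])
    fix v
    show "\<exists>t. runs (program e) v (den e (input_env v)) t \<and>
        t \<le> (usize v + 2) ^ b"
      using *[of v] b[of "usize v"] unfolding eval_within_def runs_def by (meson order_trans)
    show "usize (den e (input_env v)) \<le> (usize v + 2) ^ b"
      using *[of v] b[of "usize v"] by linarith
  qed
qed

section \<open>Edge lengths\<close>

text \<open>The expression has to work in every environment that knows \<open>m\<close>, so it can
  be inserted wherever \<open>m\<close> is bound.\<close>

definition expressible :: "(nat \<Rightarrow> nat) \<Rightarrow> bool" where
  "expressible f \<longleftrightarrow> (\<exists>e. \<forall>\<sigma> m. \<sigma> ''m'' = Num (int m) \<longrightarrow> den e \<sigma> = Num (int (f m)))"

lemma expressible_const: "expressible (\<lambda>_. c)"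
  unfolding expressible_def by (intro exI[of _ "BConst (int c)"]) simp

lemma expressible_id: "expressible (\<lambda>m. m)"
  unfolding expressible_def by (intro exI[of _ "BVar ''m''"]) simp

lemma expressible_binary:
  assumes "expressible f" "expressible g"
    and "\<And>x y. binop_val b (Num (int x)) (Num (int y)) = Num (int (h x y))"
  shows "expressible (\<lambda>m. h (f m) (g m))"
proof -
  obtain p q where "\<And>\<sigma> m. \<sigma> ''m'' = Num (int m) \<Longrightarrow> den p \<sigma> = Num (int (f m))"
    "\<And>\<sigma> m. \<sigma> ''m'' = Num (int m) \<Longrightarrow> den q \<sigma> = Num (int (g m))"
    using assms(1,2) unfolding expressible_def by blast
  then show ?thesis
    unfolding expressible_def by (intro exI[of _ "BBinary b p q"]) (simp add: assms(3))
qed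

lemma expressible_add: "expressible f \<Longrightarrow> expressible g \<Longrightarrow> expressible (\<lambda>m. f m + g m)"
  by (rule expressible_binary[of _ _ Plus]) auto

lemma expressible_mult: "expressible f \<Longrightarrow> expressible g \<Longrightarrow> expressible (\<lambda>m. f m * g m)"
  by (rule expressible_binary[of _ _ Times]) auto

lemma expressible_div: "expressible f \<Longrightarrow> expressible g \<Longrightarrow> expressible (\<lambda>m. f m div g m)"
  by (rule expressible_binary[of _ _ Div]) (auto simp: zdiv_int)

lemma expressible_power: "expressible f \<Longrightarrow> expressible (\<lambda>m. f m ^ d)"
  by (induction d) (auto intro: expressible_const expressible_mult)

text \<open>\<open>h\<close> is arbitrary: any finite table can be hard-wired as nested equality
  tests, whether or not its values follow a computable rule.\<close>

lemma expressible_patch: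
  assumes "expressible f"
  shows "expressible (\<lambda>m. if m < N then h m else f m)"
proof (induction N)
  case (Suc N)
  then obtain p where p: "\<And>\<sigma> m. \<sigma> ''m'' = Num (int m) \<Longrightarrow> den p \<sigma> = Num (int (if m < N then h m else f m))"
    unfolding expressible_def by blast
  let ?e = "BCond (BBinary Equal (BVar ''m'') (BConst (int N))) (BConst (int (h N))) p"
  have "den ?e \<sigma> = Num (int (if m < Suc N then h m else f m))" if "\<sigma> ''m'' = Num (int m)" for \<sigma> m
    using p[of \<sigma> m, OF that] that by (auto simp: less_Suc_eq)
  then show ?case unfolding expressible_def by blast
qed (simp add: assms)

text \<open>The coefficients of the polynomial need not be computable. A rational multiple of its leading
  monomial approximates it within a factor of two from some point on, and the finitely many other
  values are tabulated.\<close>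

lemma expressible_approximation:
  fixes P :: "real poly"
  assumes pos: "\<And>n. n \<ge> 1 \<Longrightarrow> poly P (real n) > 0"
    and ge1: "\<And>m. m \<ge> 1 \<Longrightarrow> poly P (real (9 * m + 1)) \<ge> 1"
  obtains L where "expressible L"
    and "\<And>m. m \<ge> 1 \<Longrightarrow> L m \<ge> 1 \<and> real (L m) \<le> poly P (real (9 * m + 1)) \<and>
      poly P (real (9 * m + 1)) \<le> 2 * real (L m) + 2"
proof -
  define g where "g m = poly P (real (9 * m + 1))" for m
  \<comment> \<open>The floor of \<open>g m\<close> always meets the requirements. It serves when
    \<open>P\<close> is constant and for the finite table.\<close>
  have floor: "nat \<lfloor>g m\<rfloor> \<ge> 1 \<and> real (nat \<lfloor>g m\<rfloor>) \<le> g m \<and> g m \<le> 2 * real (nat \<lfloor>g m\<rfloor>) + 2" if "m \<ge> 1" for m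
  proof -
    have "g m \<ge> 1" using ge1[OF that] by (simp add: g_def)
    then show ?thesis by (simp add: le_nat_iff le_floor_iff) linarith
  qed
  define d where "d = degree P"
  define a where "a = lead_coeff P"
  show thesis
  proof (cases "d = 0")
    case True
    then obtain c where "P = [:c:]" by (auto simp: d_def elim: degree_eq_zeroE)
    then have "g m = c" for m by (simp add: g_def)
    then show thesis
      using that[OF expressible_const[of "nat \<lfloor>c\<rfloor>"]] floor by (simp add: g_def)
  next
    case False
    have lim: "((\<lambda>x. poly P x / x ^ d) \<longlongrightarrow> a) at_top"
      using poly_divide_tendsto_aux[of P] at_top_le_at_infinity
      unfolding d_def a_def by (rule tendsto_mono[rotated])
    have "a \<noteq> 0" using False by (auto simp: a_def d_def)
    moreover have "a \<ge> 0"
    proof (rule tendsto_lowerbound)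
      show "((\<lambda>n. poly P (real n) / real n ^ d) \<longlongrightarrow> a) sequentially"
        using filterlim_compose[OF lim filterlim_real_sequentially] .
      show "\<forall>\<^sub>F n in sequentially. 0 \<le> poly P (real n) / real n ^ d"
        using pos by (intro eventually_sequentiallyI[of 1]) (simp add: less_imp_le)
    qed simp
    ultimately have "a / 2 < a" and "a > 0" by auto
    \<comment> \<open>With \<open>q\<close> strictly between \<open>a / 2\<close> and
      \<open>a\<close>, the limit \<open>a\<close> of \<open>poly P x / x ^ d\<close> lies strictly
      between \<open>q\<close> and \<open>2 * q\<close>; so eventually \<open>poly P x\<close> lies
      between \<open>q * x ^ d\<close> and twice that value.\<close>
    then obtain q :: rat where q: "a / 2 < of_rat q" "of_rat q < a"
      using of_rat_dense by blast
    then have "of_rat q > (0 :: real)" using \<open>a > 0\<close> by linarith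
    then have "q > 0" by simp
    obtain A B where AB: "quotient_of q = (A, B)" by fastforce
    define A' B' where "A' = nat A" and "B' = nat B"
    have "B > 0" using quotient_of_denom_pos[OF AB] .
    moreover have qAB: "q = of_int A / of_int B" using quotient_of_div[OF AB] .
    ultimately have "A > 0" using \<open>q > 0\<close> by (simp add: zero_less_divide_iff)
    have A': "A' \<ge> 1" "B' \<ge> 1" "of_rat q = real A' / real B'"
      using \<open>A > 0\<close> \<open>B > 0\<close> by (auto simp: A'_def B'_def qAB of_rat_divide)
    have "\<forall>\<^sub>F x in at_top. poly P x / x ^ d \<in> {of_rat q<..<2 * of_rat q}"
      using q by (intro topological_tendstoD[OF lim]) auto
    then obtain x0 where x0: "\<And>x. x \<ge> x0 \<Longrightarrow> poly P x / x ^ d \<in> {of_rat q<..<2 * of_rat q}"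
      unfolding eventually_at_top_linorder by blast
    define f where "f m = (A' * (9 * m + 1) ^ d) div B'" for m
    \<comment> \<open>\<open>x0\<close> provides the two inequalities above. \<open>B'\<close> makes
      the integer quotient positive: from there on the divisor is at most \<open>9 * m + 1\<close>,
      hence at most the dividend.\<close>
    define N where "N = max B' (nat \<lceil>x0\<rceil>)"
    have "expressible (\<lambda>m. if m < N then nat \<lfloor>g m\<rfloor> else f m)"
      unfolding f_def by (intro expressible_patch expressible_div expressible_mult expressible_power
          expressible_add expressible_const expressible_id)
    moreover have "f m \<ge> 1 \<and> real (f m) \<le> g m \<and> g m \<le> 2 * real (f m) + 2" if "m \<ge> N" for m
    proof -
      let ?n = "9 * m + 1"
      have "real ?n \<ge> x0" using that by (simp add: N_def)
      from x0[OF this] have g: "of_rat q * real ?n ^ d < g m" "g m < 2 * of_rat q * real ?n ^ d"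
        by (auto simp: g_def field_simps)
      have "B' \<le> ?n" using that by (simp add: N_def)
      also have "\<dots> \<le> ?n ^ d" using False by (intro self_le_power) auto
      also have "\<dots> \<le> A' * ?n ^ d" using A'(1) by simp
      finally have "B' div B' \<le> f m" unfolding f_def by (rule div_le_mono)
      then have "f m \<ge> 1" using A'(2) by simp
      have eq: "of_rat q * real ?n ^ d = real (A' * ?n ^ d) / real B'"
        by (simp add: A'(3))
      have "\<lfloor>of_rat q * real ?n ^ d\<rfloor> = int (f m)"
        unfolding eq f_def by (rule floor_divide_of_nat_eq)
      then have "real (f m) \<le> of_rat q * real ?n ^ d" "of_rat q * real ?n ^ d < real (f m) + 1"
        by linarith+
      then show ?thesis using g \<open>f m \<ge> 1\<close> by linarith
    qed
    ultimately show thesis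
      using that[of "\<lambda>m. if m < N then nat \<lfloor>g m\<rfloor> else f m"] floor by (simp add: g_def)
  qed
qed

section \<open>The instance of a formula\<close>

fun clause_lit :: "clause \<Rightarrow> nat \<Rightarrow> literal" where
  "clause_lit (l1, l2, l3) p = (if p = 0 then l1 else if p = 1 then l2 else l3)"

fun lit_neg :: "literal \<Rightarrow> bool" where
  "lit_neg (Pos x) = False"
| "lit_neg (Neg x) = True"

lemma lit_true_iff: "lit_true A l \<longleftrightarrow> A (lit_var l) \<noteq> lit_neg l"
  by (cases l) auto

lemma ex_less_3: "(\<exists>p < 3. Q p) \<longleftrightarrow> Q 0 \<or> Q 1 \<or> Q (2 :: nat)"
  by (auto simp: numeral_3_eq_3 numeral_2_eq_2 less_Suc_eq)

lemma all_less_3: "(\<forall>p < 3. Q p) \<longleftrightarrow> Q 0 \<and> Q 1 \<and> Q (2 :: nat)"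
  using ex_less_3[of "\<lambda>p. \<not> Q p"] by blast

lemma clause_lits_eq: "clause_lits c = clause_lit c ` {p. p < 3}"
proof -
  have "{p. p < 3} = {0, 1, 2 :: nat}" by auto
  then show ?thesis by (cases c) auto
qed

definition pack :: "(nat \<Rightarrow> bool) \<Rightarrow> nat" where
  "pack b = of_bool (b 0) + 2 * of_bool (b 1) + 4 * of_bool (b 2)"

definition bit_set :: "nat \<Rightarrow> nat \<Rightarrow> bool" where
  "bit_set r p \<longleftrightarrow> r div 2 ^ p mod 2 = 1"

lemma pack_less: "pack b < 8"
  by (auto simp: pack_def of_bool_def)

lemma bit_set_pack: "p < 3 \<Longrightarrow> bit_set (pack b) p = b p"
proof -
  have "\<forall>p<3. bit_set (pack b) p = b p"
    unfolding all_less_3 by (cases "b 0"; cases "b 1"; cases "b 2") (simp_all add: pack_def bit_set_def)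
  then show "p < 3 \<Longrightarrow> bit_set (pack b) p = b p" by blast
qed

lemma pack_bit_set: "r < 8 \<Longrightarrow> pack (bit_set r) = r"
proof -
  assume "r < 8"
  then have "r \<in> {0, 1, 2, 3, 4, 5, 6, 7}" by auto
  then show ?thesis by (auto simp: pack_def bit_set_def)
qed

lemma pack_cong: "(\<And>p. p < 3 \<Longrightarrow> a p = b p) \<Longrightarrow> pack a = pack b"
  by (simp add: pack_def)

lemma pack_eq_iff: "pack a = pack b \<longleftrightarrow> (\<forall>p<3. a p = b p)"
  using bit_set_pack pack_cong by metis

text \<open>
  Vertex \<open>9 * j + r\<close> belongs to clause \<open>j\<close>. For \<open>r = 8\<close> it is the client of the clause. For
  \<open>r < 8\<close> it is a facility, and the bits of \<open>r\<close> are the values that it gives to the variables of the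
  three literals. Vertex \<open>9 * m\<close> is isolated.
\<close>

definition lit_at :: "sat3 \<Rightarrow> nat \<Rightarrow> nat \<Rightarrow> literal" where
  "lit_at \<phi> j p = clause_lit (clauses \<phi> ! j) p"

text \<open>A literal is false exactly when its variable has the value \<open>lit_neg\<close>, so a
  single code falsifies the clause.\<close>

definition false_code :: "sat3 \<Rightarrow> nat \<Rightarrow> nat" where
  "false_code \<phi> j = pack (\<lambda>p. lit_neg (lit_at \<phi> j p))"

text \<open>A client has residue 8, which is never a \<open>false_code\<close>, so clients count as
  satisfying and are close to the satisfying facilities of their cluster.\<close>

definition satisfying :: "sat3 \<Rightarrow> nat \<Rightarrow> bool" where
  "satisfying \<phi> v \<longleftrightarrow> v mod 9 \<noteq> false_code \<phi> (v div 9)"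

definition asserts :: "sat3 \<Rightarrow> bool \<Rightarrow> nat \<Rightarrow> nat \<Rightarrow> bool" where
  "asserts \<phi> b x v \<longleftrightarrow> (\<exists>p < 3. lit_var (lit_at \<phi> (v div 9) p) = x \<and> bit_set (v mod 9) p = b)"

definition edge_length :: "sat3 \<Rightarrow> nat \<Rightarrow> nat \<Rightarrow> nat \<Rightarrow> nat" where
  "edge_length \<phi> L u v =
    (if u div 9 = v div 9 \<and> satisfying \<phi> u \<and> satisfying \<phi> v then 1 else L)"

definition clause_group :: "nat \<Rightarrow> nat list" where
  "clause_group j = map (\<lambda>r. 9 * j + r) [0..<8]"

text \<open>
  For \<open>i \<noteq> j\<close> at most one facility of this group may be opened, so the facilities of two clauses
  cannot contradict each other on \<open>x\<close>. For \<open>i = j\<close>, where a variable may occur twice in a clause,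
  no facility of this group may be opened.
\<close>

definition conflict_group :: "sat3 \<Rightarrow> nat \<Rightarrow> nat \<Rightarrow> nat \<Rightarrow> nat list" where
  "conflict_group \<phi> x i j = filter (\<lambda>v. v mod 9 \<noteq> 8 \<and>
      (if i = j then v div 9 = i \<and> asserts \<phi> True x v \<and> asserts \<phi> False x v
       else v div 9 = i \<and> asserts \<phi> True x v \<or> v div 9 = j \<and> asserts \<phi> False x v))
    [0..<9 * num_clauses \<phi>]"

definition conflict_limit :: "nat \<Rightarrow> nat \<Rightarrow> int" where
  "conflict_limit i j = (if i = j then 0 else 1)"

text \<open>Pairs of vertices and triples of a variable and two clauses run through one index in
  mixed radix. Each list is thereby a comprehension over a single counter, the form that
  \<open>BTab\<close> computes. All ordered pairs of clauses occur, so each clash of values is met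
  with the true side as \<open>i\<close> and the false side as \<open>j\<close>.\<close>

definition reduction :: "sat3 \<Rightarrow> nat \<Rightarrow> fr_inst" where
  "reduction \<phi> L =
    (let m = num_clauses \<phi>; N = 9 * m in
     \<lparr>budget = m,
      num_verts = N + 1,
      warcs = map (\<lambda>e. ((e div N, e mod N), of_nat (edge_length \<phi> L (e div N) (e mod N))))
        (filter (\<lambda>e. e div N \<noteq> e mod N) [0..<N * N]),
      clients = map (\<lambda>j. 9 * j + 8) [0..<m],
      facilities = filter (\<lambda>v. v mod 9 \<noteq> 8) [0..<N],
      groups = map (\<lambda>j. (clause_group j, 1, 1)) [0..<m] @
        map (\<lambda>e. (conflict_group \<phi> (e div (m * m)) (e div m mod m) (e mod m),
            0, conflict_limit (e div m mod m) (e mod m)))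
          [0..<num_vars \<phi> * (m * m)]\<rparr>)"

locale reduction_instance =
  fixes \<phi> :: sat3 and L :: nat
  assumes wf: "wf_sat3 \<phi>" and L_ge_1: "L \<ge> 1"
begin

abbreviation "m \<equiv> num_clauses \<phi>"
abbreviation "I \<equiv> reduction \<phi> L"

lemma m_pos: "m > 0"
  using wf by (simp add: wf_sat3_def num_clauses_def)

lemma lit_var_less:
  assumes "j < m" "p < 3"
  shows "lit_var (lit_at \<phi> j p) < num_vars \<phi>"
proof -
  have "clauses \<phi> ! j \<in> set (clauses \<phi>)" using assms(1) by (simp add: num_clauses_def)
  moreover have "lit_at \<phi> j p \<in> clause_lits (clauses \<phi> ! j)"
    using assms(2) by (auto simp: clause_lits_eq lit_at_def)
  ultimately show ?thesis using wf by (auto simp: wf_sat3_def)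
qed

lemma budget_I [simp]: "budget I = m"
  and num_verts_I [simp]: "num_verts I = 9 * m + 1"
  by (simp_all add: reduction_def Let_def)

lemma set_clients: "set (clients I) = (\<lambda>j. 9 * j + 8) ` {..<m}"
  by (auto simp: reduction_def Let_def)

lemma distinct_clients: "distinct (clients I)"
  by (auto simp: reduction_def Let_def distinct_map intro: inj_onI)

lemma set_facilities: "set (facilities I) = {v. v < 9 * m \<and> v mod 9 \<noteq> 8}"
  by (auto simp: reduction_def Let_def)

lemma distinct_facilities: "distinct (facilities I)"
  by (auto simp: reduction_def Let_def)

lemma div9_less: "v < 9 * m \<Longrightarrow> v div 9 < m"
  by (simp add: less_mult_imp_div_less mult.commute)

lemma points_I: "points I = {..<9 * m}"
proof -
  have "v \<in> (\<lambda>j. 9 * j + 8) ` {..<m}" if "v < 9 * m" "v mod 9 = 8" for v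
  proof (rule image_eqI)
    show "v = 9 * (v div 9) + 8" using that(2) by (metis mult_div_mod_eq)
  qed (use div9_less[OF that(1)] in simp)
  then show ?thesis
    unfolding points_def set_clients set_facilities by force
qed

lemma card_clients: "card (set (clients I)) = m"
  unfolding set_clients by (subst card_image) (auto intro: inj_onI)

lemma card_facilities: "card (set (facilities I)) = 8 * m"
proof -
  have "set (clients I) \<inter> set (facilities I) = {}"
    by (auto simp: set_clients set_facilities)
  then have "card (points I) = card (set (clients I)) + card (set (facilities I))"
    unfolding points_def by (intro card_Un_disjoint) auto
  then show ?thesis by (simp add: points_I card_clients)
qed

lemma pair_index:
  assumes "u < N" "v < N"
  shows "\<exists>e < N * N. e div N = u \<and> e mod N = (v :: nat)"
proof (intro exI[of _ "u * N + v"] conjI)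
  have "u * N + v < Suc u * N" using assms(2) by simp
  also have "\<dots> \<le> N * N" using assms(1) by (intro mult_right_mono) auto
  finally show "u * N + v < N * N" .
qed (use assms in auto)

section \<open>The weighted graph and its shortest-path metric\<close>

lemma set_warcs: "set (warcs I) =
    {((u, v), of_nat (edge_length \<phi> L u v)) | u v. u < 9 * m \<and> v < 9 * m \<and> u \<noteq> v}"
proof -
  let ?N = "9 * m"
  have N: "?N > 0" using m_pos by simp
  have "set (warcs I) = (\<lambda>(u, v). ((u, v), of_nat (edge_length \<phi> L u v))) `
      ((\<lambda>e. (e div ?N, e mod ?N)) ` {e. e < ?N * ?N \<and> e div ?N \<noteq> e mod ?N})"
    by (auto simp: reduction_def Let_def image_image)
  also have "(\<lambda>e. (e div ?N, e mod ?N)) ` {e. e < ?N * ?N \<and> e div ?N \<noteq> e mod ?N} =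
      {(u, v). u < ?N \<and> v < ?N \<and> u \<noteq> v}"
  proof (intro equalityI subsetI)
    fix w assume "w \<in> {(u, v). u < ?N \<and> v < ?N \<and> u \<noteq> v}"
    then obtain u v where w: "w = (u, v)" "u < ?N" "v < ?N" "u \<noteq> v" by auto
    from pair_index[OF w(2,3)] obtain e where "e < ?N * ?N" "e div ?N = u" "e mod ?N = v" by blast
    with w show "w \<in> (\<lambda>e. (e div ?N, e mod ?N)) ` {e. e < ?N * ?N \<and> e div ?N \<noteq> e mod ?N}"
      by (intro image_eqI[of _ _ e]) auto
  qed (use N in \<open>auto simp: less_mult_imp_div_less\<close>)
  finally show ?thesis by auto
qed

lemma distinct_warcs: "distinct (map fst (warcs I))"
proof -
  have "inj (\<lambda>e. (e div N, e mod N))" for N :: nat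
    by (intro injI) (metis div_mult_mod_eq prod.inject)
  then show ?thesis
    by (auto simp: reduction_def Let_def distinct_map comp_def intro: inj_on_subset)
qed

lemma parcs_I: "parcs (inst_graph I) = {(u, v). u < 9 * m \<and> v < 9 * m \<and> u \<noteq> v}"
  unfolding inst_graph_def by (auto simp: set_warcs image_iff)

lemma pverts_I: "pverts (inst_graph I) = {..<9 * m + 1}"
  by (simp add: inst_graph_def)

lemma inst_weight_I:
  assumes "u < 9 * m" "v < 9 * m" "u \<noteq> v"
  shows "inst_weight I (u, v) = real (edge_length \<phi> L u v)"
proof -
  have "map_of (warcs I) (u, v) = Some (of_nat (edge_length \<phi> L u v))"
    using assms by (intro map_of_is_SomeI[OF distinct_warcs]) (auto simp: set_warcs)
  then show ?thesis by (simp add: inst_weight_def)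
qed

lemma edge_length_sym: "edge_length \<phi> L u v = edge_length \<phi> L v u"
  by (auto simp: edge_length_def)

lemma edge_length_bounds: "1 \<le> edge_length \<phi> L u v" "edge_length \<phi> L u v \<le> L"
  using L_ge_1 by (auto simp: edge_length_def)

text \<open>Closeness is transitive: if both legs had length 1, all three points would be satisfying
  points of one cluster. A long edge therefore forces a long leg.\<close>

lemma edge_length_triangle: "edge_length \<phi> L u w \<le> edge_length \<phi> L u v + edge_length \<phi> L v w"
  using L_ge_1 by (auto simp: edge_length_def)

lemma pair_graph_I: "pair_graph (inst_graph I)"
proof
  show "finite (parcs (inst_graph I))"
    by (rule finite_subset[of _ "{..<9 * m} \<times> {..<9 * m}"]) (auto simp: parcs_I)
  show "symmetric (with_proj (inst_graph I))"
    by (auto simp: symmetric_def parcs_I intro: symI)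
qed (auto simp: parcs_I pverts_I)

text \<open>The graph is complete on the points and its weights obey the triangle inequality, so no
  walk is cheaper than the direct arc.\<close>

lemma inst_dist_I:
  assumes "u < 9 * m" "v < 9 * m" "u \<noteq> v"
  shows "inst_dist I u v = real (edge_length \<phi> L u v)"
proof -
  interpret pair_graph "inst_graph I" by (rule pair_graph_I)
  \<comment> \<open>The case \<open>u = v\<close> carries the induction over walks: the empty walk
    costs nothing, whereas \<open>edge_length\<close> is positive even from a vertex to
    itself.\<close>
  have *: "(if u = v then 0 else real (edge_length \<phi> L u v)) \<le> awalk_cost (inst_weight I) p"
    if "awalk u p v" "v < 9 * m" for u p v
    using that
  proof (induction p arbitrary: u)
    case Nil
    then show ?case by (simp add: awalk_Nil_iff)
  next
    case (Cons a p)
    obtain x y where a: "a = (x, y)" by fastforce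
    from Cons.prems(1) have x: "x = u" and arc: "u < 9 * m" "y < 9 * m" "u \<noteq> y" and "awalk y p v"
      by (auto simp: awalk_Cons_iff a parcs_I)
    with Cons.IH[OF \<open>awalk y p v\<close> Cons.prems(2)]
    show ?case
      using edge_length_triangle[of u v y] inst_weight_I[OF arc]
      by (auto simp: a split: if_splits simp flip: of_nat_add intro: order_trans)
  qed
  have "\<mu> (inst_weight I) u v = ereal (real (edge_length \<phi> L u v))"
  proof (rule antisym)
    have "awalk u [(u, v)] v"
      using assms by (auto simp: awalk_Cons_iff awalk_Nil_iff parcs_I pverts_I)
    from min_cost_le_walk_cost[OF this, of "inst_weight I"]
    show "\<mu> (inst_weight I) u v \<le> ereal (real (edge_length \<phi> L u v))"
      using inst_weight_I[OF assms] by simp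
    show "ereal (real (edge_length \<phi> L u v)) \<le> \<mu> (inst_weight I) u v"
      unfolding \<mu>_def
    proof (rule INF_greatest)
      fix p assume "p \<in> {p. awalk u p v}"
      then show "ereal (real (edge_length \<phi> L u v)) \<le> ereal (awalk_cost (inst_weight I) p)"
        using *[of u p v] assms by simp
    qed
  qed
  then show ?thesis by (simp add: inst_dist_def)
qed

lemma aspect_ratio_le: "aspect_ratio I \<le> real L"
proof -
  define D where "D = {inst_dist I u v | u v. u \<in> points I \<and> v \<in> points I \<and> u \<noteq> v}"
  have D: "D = (\<lambda>(u, v). inst_dist I u v) ` {(u, v). u < 9 * m \<and> v < 9 * m \<and> u \<noteq> v}"
    by (auto simp: D_def points_I)
  have "finite {(u, v). u < 9 * m \<and> v < 9 * m \<and> u \<noteq> v}"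
    by (rule finite_subset[of _ "{..<9 * m} \<times> {..<9 * m}"]) auto
  then have "finite D" unfolding D by (rule finite_imageI)
  have "inst_dist I 0 1 \<in> D"
    unfolding D using m_pos by (intro image_eqI[of _ _ "(0, 1)"]) auto
  have bounds: "1 \<le> d \<and> d \<le> real L" if "d \<in> D" for d
    using that edge_length_bounds unfolding D by (auto simp: inst_dist_I)
  have "Max D \<in> D" "Min D \<in> D"
    using \<open>finite D\<close> \<open>inst_dist I 0 1 \<in> D\<close> by (auto intro!: Max_in Min_in)
  then have "Max D / Min D \<le> real L / 1"
    using bounds by (intro frac_le) (auto dest: order_trans[of 0 1 "Max D"])
  then show ?thesis by (simp add: aspect_ratio_def D_def Let_def)
qed

section \<open>The groups\<close>

lemma mod9_cases: "v mod 9 \<noteq> 8 \<longleftrightarrow> v mod 9 < (8 :: nat)"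
  using mod_less_divisor[of 9 v] by linarith

lemma vertex_less: "v div 9 < m \<Longrightarrow> v < 9 * m"
  by (metis less_mult_imp_div_less mult.commute not_less div_le_mono nonzero_mult_div_cancel_left
      numeral_eq_iff zero_neq_numeral)

lemma set_clause_group: "set (clause_group j) = {v. v div 9 = j \<and> v mod 9 \<noteq> 8}"
proof -
  have "(\<lambda>r. 9 * j + r) ` {r. r < 8} = {v. v div 9 = j \<and> v mod 9 < 8}"
  proof (intro equalityI subsetI)
    fix v assume "v \<in> {v. v div 9 = j \<and> v mod 9 < 8}"
    then show "v \<in> (\<lambda>r. 9 * j + r) ` {r. r < 8}"
      by (intro image_eqI[of _ _ "v mod 9"]) auto
  qed auto
  then show ?thesis
    by (simp add: clause_group_def mod9_cases atLeast0LessThan lessThan_def del: image_add_atLeastLessThan')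
qed

lemma set_conflict_group:
  assumes "i < m" "j < m"
  shows "set (conflict_group \<phi> x i j) = {v. v mod 9 \<noteq> 8 \<and>
      (if i = j then v div 9 = i \<and> asserts \<phi> True x v \<and> asserts \<phi> False x v
       else v div 9 = i \<and> asserts \<phi> True x v \<or> v div 9 = j \<and> asserts \<phi> False x v)}"
  using assms vertex_less by (auto simp: conflict_group_def split: if_splits)

lemma triple_index:
  assumes "x < n" "i < M" "j < M"
  shows "\<exists>e < n * (M * M). e div (M * M) = x \<and> e div M mod M = i \<and> e mod M = (j :: nat)"
proof (intro exI[of _ "(x * M + i) * M + j"] conjI)
  have "x * M + i < n * M"
  proof -
    have "x * M + i < Suc x * M" using assms(2) by simp
    also have "\<dots> \<le> n * M" using assms(1) by (intro mult_right_mono) auto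
    finally show ?thesis .
  qed
  then have "Suc (x * M + i) * M \<le> n * M * M" by (intro mult_right_mono) auto
  then show "(x * M + i) * M + j < n * (M * M)" using assms(3) by (simp add: mult.assoc)
  show "((x * M + i) * M + j) div (M * M) = x"
    using assms by (simp add: div_mult2_eq)
qed (use assms in auto)

lemma set_groups: "set (groups I) = {(clause_group j, 1, 1) | j. j < m} \<union>
    {(conflict_group \<phi> x i j, 0, conflict_limit i j) | x i j. x < num_vars \<phi> \<and> i < m \<and> j < m}"
proof -
  let ?f = "\<lambda>(x, i, j). (conflict_group \<phi> x i j, 0 :: int, conflict_limit i j)"
  let ?idx = "\<lambda>e. (e div (m * m), e div m mod m, e mod m)"
  have "set (groups I) = (\<lambda>j. (clause_group j, 1, 1)) ` {..<m} \<union>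
      ?f ` ?idx ` {..<num_vars \<phi> * (m * m)}"
    by (auto simp: reduction_def Let_def image_image)
  also have "?idx ` {..<num_vars \<phi> * (m * m)} = {..<num_vars \<phi>} \<times> {..<m} \<times> {..<m}"
  proof (intro equalityI subsetI)
    fix t assume "t \<in> {..<num_vars \<phi>} \<times> {..<m} \<times> {..<m}"
    then obtain x i j where t: "t = (x, i, j)" "x < num_vars \<phi>" "i < m" "j < m" by auto
    from triple_index[OF t(2-4)] obtain e where
      "e < num_vars \<phi> * (m * m)" "e div (m * m) = x" "e div m mod m = i" "e mod m = j" by blast
    with t(1) show "t \<in> ?idx ` {..<num_vars \<phi> * (m * m)}"
      by (intro image_eqI[of _ _ e]) auto
  qed (use m_pos in \<open>auto simp: less_mult_imp_div_less\<close>)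
  also have "?f ` ({..<num_vars \<phi>} \<times> {..<m} \<times> {..<m}) = {(conflict_group \<phi> x i j, 0 :: int, conflict_limit i j) |
      x i j. x < num_vars \<phi> \<and> i < m \<and> j < m}"
  proof (intro equalityI subsetI)
    fix g :: "nat list \<times> int \<times> int"
    assume "g \<in> {(conflict_group \<phi> x i j, 0, conflict_limit i j) | x i j.
      x < num_vars \<phi> \<and> i < m \<and> j < m}"
    then obtain x i j where "g = ?f (x, i, j)" "x < num_vars \<phi>" "i < m" "j < m" by auto
    then show "g \<in> ?f ` ({..<num_vars \<phi>} \<times> {..<m} \<times> {..<m})"
      by (intro image_eqI[of _ _ "(x, i, j)"]) auto
  qed auto
  also have "(\<lambda>j. (clause_group j, 1 :: int, 1 :: int)) ` {..<m} = {(clause_group j, 1, 1) | j. j < m}"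
    by auto
  finally show ?thesis .
qed

lemma wf_inst_I: "wf_inst I"
proof -
  interpret pair_graph "inst_graph I" by (rule pair_graph_I)
  show ?thesis
    unfolding wf_inst_def
  proof (intro conjI)
    show "groups I \<noteq> []"
      using m_pos by (simp add: reduction_def Let_def)
    show "points I \<subseteq> {..<num_verts I}" by (auto simp: points_I)
    show "\<forall>(u, v)\<in>parcs (inst_graph I). 0 < inst_weight I (u, v) \<and> inst_weight I (u, v) = inst_weight I (v, u)"
      using edge_length_bounds(1) edge_length_sym by (auto simp: parcs_I inst_weight_I Suc_le_eq)
    show "\<forall>u\<in>points I. \<forall>v\<in>points I. u \<rightarrow>\<^sup>*\<^bsub>with_proj (inst_graph I)\<^esub> v"
    proof (intro ballI)
      fix u v assume "u \<in> points I" "v \<in> points I"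
      then show "u \<rightarrow>\<^sup>*\<^bsub>with_proj (inst_graph I)\<^esub> v"
        by (cases "u = v") (auto simp: points_I parcs_I pverts_I)
    qed
    show "\<forall>(G, \<alpha>, \<beta>)\<in>set (groups I). set G \<subseteq> set (facilities I) \<and> \<alpha> \<le> \<beta>"
      by (auto simp: set_groups set_facilities set_clause_group set_conflict_group vertex_less conflict_limit_def)
  qed (use m_pos distinct_warcs pair_graph_I distinct_clients distinct_facilities in auto)
qed

section \<open>Feasible solutions and assignments\<close>

definition chosen :: "(nat \<Rightarrow> bool) \<Rightarrow> nat \<Rightarrow> nat" where
  "chosen A j = 9 * j + pack (\<lambda>p. A (lit_var (lit_at \<phi> j p)))"

lemma chosen_div [simp]: "chosen A j div 9 = j"
  and chosen_mod [simp]: "chosen A j mod 9 = pack (\<lambda>p. A (lit_var (lit_at \<phi> j p)))"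
  using pack_less[of "\<lambda>p. A (lit_var (lit_at \<phi> j p))"] by (simp_all add: chosen_def)

lemma chosen_mod_less: "chosen A j mod 9 < 8"
  by (simp add: pack_less)

lemma asserts_chosen: "asserts \<phi> b x (chosen A j) \<Longrightarrow> A x = b"
  by (auto simp: asserts_def bit_set_pack)

lemma satisfying_chosen:
  "satisfying \<phi> (chosen A j) \<longleftrightarrow> (\<exists>l \<in> clause_lits (clauses \<phi> ! j). lit_true A l)"
  by (auto simp: satisfying_def false_code_def pack_eq_iff clause_lits_eq lit_true_iff lit_at_def)

text \<open>A conflict group pits \<open>x\<close> true in clause \<open>i\<close> against
  \<open>x\<close> false in clause \<open>j\<close>. Facilities chosen by one assignment can lie on
  one side only, and that side contains facilities of a single cluster.\<close>

lemma feasible_chosen: "feasible I (chosen A ` {..<m})"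
  unfolding feasible_def
proof (intro conjI ballI)
  let ?S = "chosen A ` {..<m}"
  show "?S \<subseteq> set (facilities I)"
    using chosen_mod_less by (auto simp: set_facilities mod9_cases intro!: vertex_less simp del: chosen_mod)
  show "card ?S \<le> budget I"
    using card_image_le[of "{..<m}" "chosen A"] by simp
  fix g assume "g \<in> set (groups I)"
  then consider j where "j < m" "g = (clause_group j, 1, 1)"
    | x i j where "i < m" "j < m" "g = (conflict_group \<phi> x i j, 0, conflict_limit i j)"
    by (auto simp: set_groups)
  then show "case g of (G, \<alpha>, \<beta>) \<Rightarrow> \<alpha> \<le> int (card (?S \<inter> set G)) \<and> int (card (?S \<inter> set G)) \<le> \<beta>"
  proof cases
    case 1
    then have "?S \<inter> set (clause_group j) = {chosen A j}"
      using chosen_mod_less by (auto simp: set_clause_group mod9_cases simp del: chosen_mod)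
    then show ?thesis using 1 by simp
  next
    case 2
    have "?S \<inter> set (conflict_group \<phi> x i j) \<subseteq> (if i = j then {} else if A x then {chosen A i} else {chosen A j})"
      unfolding set_conflict_group[OF 2(1,2)] by (auto dest!: asserts_chosen)
    then have "card (?S \<inter> set (conflict_group \<phi> x i j)) \<le>
        card (if i = j then {} else if A x then {chosen A i} else {chosen A j})"
      by (rule card_mono[rotated]) auto
    also have "\<dots> \<le> (if i = j then 0 else 1)" by simp
    finally have "int (card (?S \<inter> set (conflict_group \<phi> x i j))) \<le> conflict_limit i j"
      by (auto simp: conflict_limit_def simp del: card_0_eq split: if_splits)
    then show ?thesis using 2(3) by simp
  qed
qed

text \<open>Each clause group yields one opened facility, hence values for the variables of its
  clause. The conflict groups make these local values agree, between clauses and between repeated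
  occurrences in one clause, so they glue to an assignment.\<close>

lemma feasible_imp_chosen:
  assumes "feasible I S"
  obtains A where "S = chosen A ` {..<m}"
proof -
  have S: "v div 9 < m" "v mod 9 < 8" if "v \<in> S" for v
    using assms that by (auto simp: feasible_def set_facilities mod9_cases div9_less)
  have "finite S"
    using assms finite_subset by (auto simp: feasible_def)
  have "\<exists>v. S \<inter> set (clause_group j) = {v}" if "j < m" for j
  proof -
    have "card (S \<inter> set (clause_group j)) = 1"
      using assms that by (force simp: feasible_def set_groups)
    then show ?thesis by (rule card_1_singletonE) blast
  qed
  then obtain s where s: "\<And>j. j < m \<Longrightarrow> S \<inter> set (clause_group j) = {s j}" by metis
  have s_S: "s j \<in> S" and s_div: "s j div 9 = j" if "j < m" for j
    using s[OF that] by (auto simp: set_clause_group)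
  have S_s: "v = s (v div 9)" if "v \<in> S" for v
    using s[OF S(1)[OF that]] S(2)[OF that] that by (auto simp: set_clause_group mod9_cases)
  \<comment> \<open>One opened facility that asserts \<open>x\<close> suffices to make
    \<open>x\<close> true; what remains to be shown is that no other opened facility denies
    it.\<close>
  define A where "A x \<longleftrightarrow> (\<exists>i < m. asserts \<phi> True x (s i))" for x
  have A: "A (lit_var (lit_at \<phi> j p)) = bit_set (s j mod 9) p" if "j < m" "p < 3" for j p
  proof -
    let ?x = "lit_var (lit_at \<phi> j p)"
    have a: "asserts \<phi> (bit_set (s j mod 9) p) ?x (s j)"
      using that s_div by (auto simp: asserts_def)
    show ?thesis
    proof (cases "bit_set (s j mod 9) p")
      case True
      then show ?thesis using a that(1) by (auto simp: A_def)
    next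
      case False
      have "\<not> A ?x"
      proof
        assume "A ?x"
        then obtain i where i: "i < m" "asserts \<phi> True ?x (s i)" by (auto simp: A_def)
        let ?G = "set (conflict_group \<phi> ?x i j)"
        have "(conflict_group \<phi> ?x i j, 0, conflict_limit i j) \<in> set (groups I)"
          using i(1) that lit_var_less[OF that] unfolding set_groups by blast
        then have card: "card (S \<inter> ?G) \<le> (if i = j then 0 else 1)"
          using assms by (fastforce simp: feasible_def conflict_limit_def split: if_splits)
        have "{s i, s j} \<subseteq> S \<inter> ?G"
          using i a False that(1) s_S S(2)[OF s_S] s_div
          unfolding set_conflict_group[OF i(1) that(1)] by (auto simp: mod9_cases)
        then have "card {s i, s j} \<le> card (S \<inter> ?G)"
          using \<open>finite S\<close> by (intro card_mono) auto
        moreover have "s i \<noteq> s j" if "i \<noteq> j"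
          using s_div i(1) \<open>j < m\<close> that by metis
        \<comment> \<open>For \<open>i = j\<close> the two facilities coincide and the limit 0
          excludes even one; for \<open>i \<noteq> j\<close> they are two against a limit of
          1.\<close>
        ultimately show False using card by (cases "i = j") auto
      qed
      with False show ?thesis by simp
    qed
  qed
  have chosen: "s j = chosen A j" if "j < m" for j
  proof -
    have "chosen A j mod 9 = pack (bit_set (s j mod 9))"
      unfolding chosen_mod by (rule pack_cong) (rule A[OF that])
    also have "\<dots> = s j mod 9"
      by (rule pack_bit_set[OF S(2)[OF s_S[OF that]]])
    finally show ?thesis
      using s_div[OF that] chosen_div by (metis mult_div_mod_eq)
  qed
  have "S = s ` {..<m}"
    using S_s s_S S(1) by auto
  then have "S = chosen A ` {..<m}"
    using chosen by (auto intro: image_eqI)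
  then show thesis by (rule that)
qed

section \<open>The cost of an assignment\<close>

lemma satisfying_client: "satisfying \<phi> (9 * j + 8)"
  using pack_less[of "\<lambda>p. lit_neg (lit_at \<phi> j p)"] by (simp add: satisfying_def false_code_def)

lemma cost_chosen:
  "cost I (chosen A ` {..<m}) = ereal (real (num_sat \<phi> A) + real L * real (m - num_sat \<phi> A))"
proof -
  define J where "J = {j. j < m \<and> (\<exists>l \<in> clause_lits (clauses \<phi> ! j). lit_true A l)}"
  have J: "J \<subseteq> {..<m}" "card J = num_sat \<phi> A"
    by (auto simp: J_def num_sat_def)
  have client: "(INF s \<in> chosen A ` {..<m}. ereal (inst_dist I (9 * j + 8) s)) =
      ereal (if j \<in> J then 1 else real L)" if "j < m" for j
  proof -
    \<comment> \<open>Facilities of other clusters are at distance \<open>L\<close>, so the minimum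
      for a falsified clause is still \<open>L\<close>, and for a satisfied one it is attained in
      its own cluster.\<close>
    have dist: "inst_dist I (9 * j + 8) (chosen A i) = (if i = j \<and> j \<in> J then 1 else real L)"
      if "i < m" for i
    proof -
      have "9 * j + 8 \<noteq> chosen A i"
      proof
        assume "9 * j + 8 = chosen A i"
        then have "(9 * j + 8) mod 9 = chosen A i mod 9" by (rule arg_cong)
        then show False using chosen_mod_less[of A i] by (simp del: chosen_mod)
      qed
      then show ?thesis
        using that \<open>j < m\<close> satisfying_client
        by (subst inst_dist_I) (auto simp: vertex_less edge_length_def satisfying_chosen J_def)
    qed
    show ?thesis
    proof (rule antisym)
      show "(INF s \<in> chosen A ` {..<m}. ereal (inst_dist I (9 * j + 8) s)) \<le> ereal (if j \<in> J then 1 else real L)"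
        using that by (intro INF_lower2[of "chosen A j"]) (auto simp: dist)
      show "ereal (if j \<in> J then 1 else real L) \<le> (INF s \<in> chosen A ` {..<m}. ereal (inst_dist I (9 * j + 8) s))"
        using L_ge_1 by (intro INF_greatest) (auto simp: dist)
    qed
  qed
  have "cost I (chosen A ` {..<m}) = (\<Sum>j<m. ereal (if j \<in> J then 1 else real L))"
    unfolding cost_def set_clients using client by (subst sum.reindex) (auto intro: inj_onI)
  also have "\<dots> = ereal (\<Sum>j<m. if j \<in> J then 1 else real L)"
    by simp
  also have "(\<Sum>j<m. if j \<in> J then 1 else real L) = real (card J) + real L * real (m - card J)"
  proof -
    have "{..<m} \<inter> J = J" "card ({..<m} - J) = m - card J"
      using J(1) by (auto simp: card_Diff_subset finite_subset)
    then show ?thesis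
      by (simp add: sum.If_cases Diff_eq[symmetric] mult.commute)
  qed
  finally show ?thesis unfolding J(2) .
qed

lemma num_sat_le: "num_sat \<phi> A \<le> m"
proof -
  have "num_sat \<phi> A \<le> card {..<m}"
    unfolding num_sat_def by (intro card_mono) auto
  then show ?thesis by simp
qed

lemma length_groups: "length (groups I) = m + num_vars \<phi> * m\<^sup>2"
  by (simp add: reduction_def Let_def power2_eq_square)

end

section \<open>Programs\<close>

abbreviation "holds c \<sigma> \<equiv> den c \<sigma> \<noteq> Num 0"

definition and_expr :: "bexp \<Rightarrow> bexp \<Rightarrow> bexp" where
  "and_expr p q = BCond p q (BConst 0)"

definition or_expr :: "bexp \<Rightarrow> bexp \<Rightarrow> bexp" where
  "or_expr p q = BCond p (BConst 1) q"

definition not_expr :: "bexp \<Rightarrow> bexp" where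
  "not_expr p = BCond p (BConst 0) (BConst 1)"

definition eq_expr :: "bexp \<Rightarrow> bexp \<Rightarrow> bexp" where
  "eq_expr = BBinary Equal"

section \<open>Evaluation of connectives, arithmetic and lists\<close>

lemma holds_and [simp]: "holds (and_expr p q) \<sigma> \<longleftrightarrow> holds p \<sigma> \<and> holds q \<sigma>"
  by (simp add: and_expr_def)

lemma holds_or [simp]: "holds (or_expr p q) \<sigma> \<longleftrightarrow> holds p \<sigma> \<or> holds q \<sigma>"
  by (simp add: or_expr_def)

lemma holds_not [simp]: "holds (not_expr p) \<sigma> \<longleftrightarrow> \<not> holds p \<sigma>"
  by (simp add: not_expr_def)

lemma holds_eq:
  "den p \<sigma> = Num (int a) \<Longrightarrow> den q \<sigma> = Num (int b) \<Longrightarrow> holds (eq_expr p q) \<sigma> \<longleftrightarrow> a = b"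
  by (simp add: eq_expr_def)

lemma den_Plus: "den p \<sigma> = Num (int a) \<Longrightarrow> den q \<sigma> = Num (int b) \<Longrightarrow>
    den (BBinary Plus p q) \<sigma> = Num (int (a + b))"
  by simp

lemma den_Times: "den p \<sigma> = Num (int a) \<Longrightarrow> den q \<sigma> = Num (int b) \<Longrightarrow>
    den (BBinary Times p q) \<sigma> = Num (int (a * b))"
  by simp

lemma den_Div: "den p \<sigma> = Num (int a) \<Longrightarrow> den q \<sigma> = Num (int b) \<Longrightarrow>
    den (BBinary Div p q) \<sigma> = Num (int (a div b))"
  by (simp add: zdiv_int)

lemma den_Mod: "den p \<sigma> = Num (int a) \<Longrightarrow> den q \<sigma> = Num (int b) \<Longrightarrow>
    den (BBinary Mod p q) \<sigma> = Num (int (a mod b))"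
  by (simp add: zmod_int)

lemma den_nat_const: "den (BConst (int n)) \<sigma> = Num (int n)"
  by simp

lemma enc_list_Nil [simp]: "enc_list enc [] = Num 0"
  and enc_list_Cons [simp]: "enc_list enc (x # xs) = Node (enc x) (enc_list enc xs)"
  by (simp_all add: enc_list_def)

lemma Tail_power_enc_list:
  "k \<le> length xs \<Longrightarrow> (unop_val Tail ^^ k) (enc_list enc xs) = enc_list enc (drop k xs)"
  by (induction k) (auto simp: Cons_nth_drop_Suc[symmetric])

lemma Head_Tail_power_enc_list:
  "k < length xs \<Longrightarrow> unop_val Head ((unop_val Tail ^^ k) (enc_list enc xs)) = enc (xs ! k)"
  by (simp add: Tail_power_enc_list Cons_nth_drop_Suc[symmetric])

lemma spine_enc_list: "spine (enc_list enc xs) = length xs"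
  by (induction xs) auto

text \<open>The rule through which every list of the instance is evaluated. Its premises are
  restricted to \<open>j < N\<close>, since the inner expressions are meaningful only for valid
  vertices and clauses.\<close>

lemma den_BTab:
  assumes "den n \<sigma> = Num (int N)" and "den r \<sigma> = enc_list enc ys"
    and "\<And>j. j < N \<Longrightarrow> holds c (\<sigma>(i := Num (int j))) \<longleftrightarrow> P j"
    and "\<And>j. j < N \<Longrightarrow> P j \<Longrightarrow> den p (\<sigma>(i := Num (int j))) = enc (f j)"
  shows "den (BTab i n c p r) \<sigma> = enc_list enc (map f (filter P [0..<N]) @ ys)"
proof -
  have "foldr (\<lambda>j acc. if holds c (\<sigma>(i := Num (int j)))
        then Node (den p (\<sigma>(i := Num (int j)))) acc else acc) js (enc_list enc ys) =
      enc_list enc (map f (filter P js) @ ys)" if "\<forall>j \<in> set js. j < N" for js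
    using that assms(3,4) by (induction js) (auto simp del: fun_upd_apply)
  from this[of "[0..<N]"] show ?thesis
    using assms(1,2) by (simp del: fun_upd_apply)
qed

lemma enc_rat_of_nat: "enc_rat (of_nat n) = Node (Num (int n)) (Num 1)"
  using quotient_of_int[of "int n"] by (simp add: enc_rat_def)

section \<open>Expressions for the instance and for a feasible solution\<close>

definition lit_expr :: "bexp \<Rightarrow> nat \<Rightarrow> bexp" where
  "lit_expr j p = BUnary Head (BDrop (BConst (int p))
    (BUnary Head (BDrop j (BUnary Tail (BVar ''in'')))))"

definition bit_expr :: "bexp \<Rightarrow> nat \<Rightarrow> bexp" where
  "bit_expr r p = BBinary Mod (BBinary Div r (BConst (int (2 ^ p)))) (BConst (int 2))"

definition div9_expr :: "bexp \<Rightarrow> bexp" where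
  "div9_expr v = BBinary Div v (BConst (int 9))"

definition mod9_expr :: "bexp \<Rightarrow> bexp" where
  "mod9_expr v = BBinary Mod v (BConst (int 9))"

text \<open>An encoded literal starts with 1 if it is positive, so the sum collects
  \<open>2 ^ p\<close> for the negative literals, which is the \<open>false_code\<close>.\<close>

definition satisfying_expr :: "bexp \<Rightarrow> bexp" where
  "satisfying_expr v =
    (let b = \<lambda>p. BCond (BUnary Head (lit_expr (div9_expr v) p)) (BConst 0) (BConst (2 ^ p))
     in not_expr (eq_expr (mod9_expr v) (BBinary Plus (b 0) (BBinary Plus (b 1) (b 2)))))"

definition asserts_expr :: "bool \<Rightarrow> bexp \<Rightarrow> bexp \<Rightarrow> bexp" where
  "asserts_expr b x v =
    (let a = \<lambda>p. and_expr (eq_expr (BUnary Tail (lit_expr (div9_expr v) p)) x)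
        (eq_expr (bit_expr (mod9_expr v) p) (BConst (int (of_bool b))))
     in or_expr (a 0) (or_expr (a 1) (a 2)))"

definition edge_expr :: "bexp \<Rightarrow> bexp \<Rightarrow> bexp" where
  "edge_expr u v = BCond (and_expr (eq_expr (div9_expr u) (div9_expr v))
      (and_expr (satisfying_expr u) (satisfying_expr v))) (BConst 1) (BVar ''L'')"

text \<open>The final constant 1 is the denominator of the weight, which is an integer.\<close>

definition warc_expr :: bexp where
  "warc_expr = BBinary MkNode (BBinary MkNode (BVar ''u'') (BVar ''v''))
    (BBinary MkNode (edge_expr (BVar ''u'') (BVar ''v'')) (BConst 1))"

definition conflict_mem_expr :: bexp where
  "conflict_mem_expr =
    (let v = BVar ''v''; x = BVar ''x''; i = BVar ''i''; j = BVar ''j'';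
      iv = eq_expr (div9_expr v) i; jv = eq_expr (div9_expr v) j
     in and_expr (not_expr (eq_expr (mod9_expr v) (BConst (int 8))))
       (BCond (eq_expr i j)
         (and_expr iv (and_expr (asserts_expr True x v) (asserts_expr False x v)))
         (or_expr (and_expr iv (asserts_expr True x v)) (and_expr jv (asserts_expr False x v)))))"

definition points_expr :: bexp where
  "points_expr = BBinary Times (BConst (int 9)) (BVar ''m'')"

definition group_expr :: bexp where
  "group_expr =
    BLet ''x'' (BBinary Div (BVar ''e'') (BBinary Times (BVar ''m'') (BVar ''m'')))
    (BLet ''i'' (BBinary Mod (BBinary Div (BVar ''e'') (BVar ''m'')) (BVar ''m''))
    (BLet ''j'' (BBinary Mod (BVar ''e'') (BVar ''m''))
      (BBinary MkNode (BTab ''v'' points_expr conflict_mem_expr (BVar ''v'') (BConst 0))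
        (BBinary MkNode (BConst 0) (BCond (eq_expr (BVar ''i'') (BVar ''j'')) (BConst 0) (BConst 1))))))"

definition warcs_expr :: bexp where
  "warcs_expr =
    (let u = BBinary Div (BVar ''e'') points_expr; v = BBinary Mod (BVar ''e'') points_expr
     in BTab ''e'' (BBinary Times points_expr points_expr) (not_expr (eq_expr u v))
       (BLet ''u'' u (BLet ''v'' v warc_expr)) (BConst 0))"


definition clients_expr :: bexp where
  "clients_expr = BTab ''e'' (BVar ''m'') (BConst 1)
    (BBinary Plus (BBinary Times (BConst (int 9)) (BVar ''e'')) (BConst (int 8))) (BConst 0)"

definition facilities_expr :: bexp where
  "facilities_expr = BTab ''e'' points_expr
    (not_expr (eq_expr (mod9_expr (BVar ''e'')) (BConst (int 8)))) (BVar ''e'') (BConst 0)"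

text \<open>Appending costs no extra construct: the conflict groups are passed as the initial list
  \<open>r\<close> of the tabulation.\<close>

definition clause_groups_expr :: "bexp \<Rightarrow> bexp" where
  "clause_groups_expr r = BTab ''e'' (BVar ''m'') (BConst 1)
    (BBinary MkNode
      (BTab ''v'' (BConst (int 8)) (BConst 1)
        (BBinary Plus (BBinary Times (BConst (int 9)) (BVar ''e'')) (BVar ''v'')) (BConst 0))
      (BBinary MkNode (BConst 1) (BConst 1))) r"

definition conflict_groups_expr :: bexp where
  "conflict_groups_expr = BTab ''e''
    (BBinary Times (BUnary Head (BVar ''in'')) (BBinary Times (BVar ''m'') (BVar ''m'')))
    (BConst 1) group_expr (BConst 0)"

definition reduction_expr :: "bexp \<Rightarrow> bexp" where
  "reduction_expr len =
    BLet ''m'' (BLen (BUnary Tail (BVar ''in'')))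
    (BLet ''L'' len
      (foldr (BBinary MkNode)
        [BVar ''m'', BBinary Plus points_expr (BConst (int 1)), warcs_expr, clients_expr,
         facilities_expr, clause_groups_expr conflict_groups_expr]
        (BConst 0)))"

text \<open>The head of an encoded instance is its budget, which equals the number of clauses.
  Vertex \<open>9 * j\<close> carries code 0, so the all-false assignment is opened without looking
  at the groups.\<close>

definition solution_expr :: bexp where
  "solution_expr = BTab ''e'' (BUnary Head (BVar ''in'')) (BConst 1)
    (BBinary Times (BConst (int 9)) (BVar ''e'')) (BConst 0)"

section \<open>The expressions denote the instance\<close>

context reduction_instance
begin

text \<open>Nothing is said about the other variables, so the condition survives every binding of a
  loop variable.\<close>

definition reduction_env :: "(string \<Rightarrow> val) \<Rightarrow> bool" where
  "reduction_env \<sigma> \<longleftrightarrow> \<sigma> ''in'' = enc_sat3 \<phi> \<and> \<sigma> ''m'' = Num (int m) \<and> \<sigma> ''L'' = Num (int L)"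

lemma reduction_env_upd:
  "reduction_env \<sigma> \<Longrightarrow> x \<notin> {''in'', ''m'', ''L''} \<Longrightarrow> reduction_env (\<sigma>(x := v))"
  by (auto simp: reduction_env_def)

lemma den_lit_expr:
  assumes "reduction_env \<sigma>" "den j \<sigma> = Num (int k)" "k < m" "p < 3"
  shows "den (lit_expr j p) \<sigma> = enc_literal (lit_at \<phi> k p)"
proof -
  obtain l1 l2 l3 where c: "clauses \<phi> ! k = (l1, l2, l3)" by (cases "clauses \<phi> ! k")
  have "unop_val Head ((unop_val Tail ^^ k) (enc_list enc_clause (clauses \<phi>))) =
      enc_list enc_literal [l1, l2, l3]"
    using assms(3) c by (simp add: Head_Tail_power_enc_list num_clauses_def)
  moreover have "unop_val Head ((unop_val Tail ^^ p) (enc_list enc_literal [l1, l2, l3])) =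
      enc_literal ([l1, l2, l3] ! p)"
    using assms(4) by (intro Head_Tail_power_enc_list) simp
  moreover have "[l1, l2, l3] ! p = lit_at \<phi> k p"
    using assms(4) c by (auto simp: lit_at_def numeral_3_eq_3 less_Suc_eq)
  ultimately show ?thesis
    using assms(1,2) by (simp add: lit_expr_def reduction_env_def enc_sat3_def)
qed

lemma den_bit_expr:
  assumes "den r \<sigma> = Num (int k)"
  shows "den (bit_expr r p) \<sigma> = Num (int (of_bool (bit_set k p)))"
proof -
  have "den (bit_expr r p) \<sigma> = Num (int (k div 2 ^ p mod 2))"
    unfolding bit_expr_def by (intro den_Mod den_Div assms den_nat_const)
  then show ?thesis by (auto simp: bit_set_def)
qed

lemma den_div9_expr: "den v \<sigma> = Num (int k) \<Longrightarrow> den (div9_expr v) \<sigma> = Num (int (k div 9))"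
  unfolding div9_expr_def by (intro den_Div den_nat_const)

lemma den_mod9_expr: "den v \<sigma> = Num (int k) \<Longrightarrow> den (mod9_expr v) \<sigma> = Num (int (k mod 9))"
  unfolding mod9_expr_def by (intro den_Mod den_nat_const)

lemma enc_literal_parts:
  "unop_val Head (enc_literal l) = truth (\<not> lit_neg l)"
  "unop_val Tail (enc_literal l) = Num (int (lit_var l))"
  by (cases l; simp add: enc_nat_def)+

lemma holds_satisfying_expr:
  assumes "reduction_env \<sigma>" "den v \<sigma> = Num (int k)" "k < 9 * m"
  shows "holds (satisfying_expr v) \<sigma> \<longleftrightarrow> satisfying \<phi> k"
proof -
  let ?b = "\<lambda>p. BCond (BUnary Head (lit_expr (div9_expr v) p)) (BConst 0) (BConst (2 ^ p))"
  have b: "den (?b p) \<sigma> = Num (int (2 ^ p * of_bool (lit_neg (lit_at \<phi> (k div 9) p))))" if "p < 3" for p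
    using den_lit_expr[OF assms(1) den_div9_expr[OF assms(2)] div9_less[OF assms(3)] that]
    by (simp add: enc_literal_parts)
  have "den (BBinary Plus (?b 0) (BBinary Plus (?b 1) (?b 2))) \<sigma> = Num (int (false_code \<phi> (k div 9)))"
  proof -
    have "den (BBinary Plus (?b 0) (BBinary Plus (?b 1) (?b 2))) \<sigma> =
        Num (int (2 ^ 0 * of_bool (lit_neg (lit_at \<phi> (k div 9) 0)) +
          (2 ^ 1 * of_bool (lit_neg (lit_at \<phi> (k div 9) 1)) +
           2 ^ 2 * of_bool (lit_neg (lit_at \<phi> (k div 9) 2)))))"
      by (intro den_Plus b) simp_all
    also have "\<dots> = Num (int (false_code \<phi> (k div 9)))"
      by (simp add: false_code_def pack_def)
    finally show ?thesis .
  qed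
  then show ?thesis
    unfolding satisfying_expr_def Let_def holds_not
    by (subst holds_eq[OF den_mod9_expr[OF assms(2)]]) (auto simp: satisfying_def)
qed

lemma holds_asserts_expr:
  assumes "reduction_env \<sigma>" "den v \<sigma> = Num (int k)" "k < 9 * m" "den x \<sigma> = Num (int y)"
  shows "holds (asserts_expr b x v) \<sigma> \<longleftrightarrow> asserts \<phi> b y k"
proof -
  have var: "den (BUnary Tail (lit_expr (div9_expr v) p)) \<sigma> = Num (int (lit_var (lit_at \<phi> (k div 9) p)))"
    if "p < 3" for p
    using den_lit_expr[OF assms(1) den_div9_expr[OF assms(2)] div9_less[OF assms(3)] that]
    by (simp add: enc_literal_parts)
  have a: "holds (and_expr (eq_expr (BUnary Tail (lit_expr (div9_expr v) p)) x)
      (eq_expr (bit_expr (mod9_expr v) p) (BConst (int (of_bool b))))) \<sigma> \<longleftrightarrow>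
      lit_var (lit_at \<phi> (k div 9) p) = y \<and> bit_set (k mod 9) p = b" if "p < 3" for p
    unfolding holds_and holds_eq[OF var[OF that] assms(4)]
      holds_eq[OF den_bit_expr[OF den_mod9_expr[OF assms(2)]] den_nat_const]
    by (simp add: of_bool_eq_iff)
  have less: "(0 :: nat) < 3" "(1 :: nat) < 3" "(2 :: nat) < 3" by simp_all
  show ?thesis
    unfolding asserts_expr_def Let_def asserts_def holds_or ex_less_3 a[OF less(1)]
      a[OF less(2)] a[OF less(3)] ..
qed

lemma den_edge_expr:
  assumes "reduction_env \<sigma>" "den u \<sigma> = Num (int k)" "den v \<sigma> = Num (int l)" "k < 9 * m" "l < 9 * m"
  shows "den (edge_expr u v) \<sigma> = Num (int (edge_length \<phi> L k l))"
proof -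
  have "den (BVar ''L'') \<sigma> = Num (int L)" using assms(1) by (simp add: reduction_env_def)
  then show ?thesis
    unfolding edge_expr_def den.simps(5) holds_and
      holds_eq[OF den_div9_expr[OF assms(2)] den_div9_expr[OF assms(3)]]
      holds_satisfying_expr[OF assms(1,2,4)] holds_satisfying_expr[OF assms(1,3,5)]
    by (simp add: edge_length_def)
qed

lemma den_points_expr: "reduction_env \<sigma> \<Longrightarrow> den points_expr \<sigma> = Num (int (9 * m))"
  unfolding points_expr_def by (intro den_Times den_nat_const) (simp add: reduction_env_def)

lemma den_warcs_expr:
  assumes "reduction_env \<sigma>"
  shows "den warcs_expr \<sigma> = enc_list enc_warc (warcs I)"
proof -
  let ?N = "9 * m"
  let ?u = "BBinary Div (BVar ''e'') points_expr" and ?v = "BBinary Mod (BVar ''e'') points_expr"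
  have "den warcs_expr \<sigma> = enc_list enc_warc
      (map (\<lambda>e. ((e div ?N, e mod ?N), of_nat (edge_length \<phi> L (e div ?N) (e mod ?N))))
        (filter (\<lambda>e. e div ?N \<noteq> e mod ?N) [0..<?N * ?N]) @ [])"
    unfolding warcs_expr_def Let_def
  proof (rule den_BTab)
    show "den (BBinary Times points_expr points_expr) \<sigma> = Num (int (?N * ?N))"
      by (intro den_Times den_points_expr assms)
    fix e assume e: "e < ?N * ?N"
    let ?\<sigma> = "\<sigma>(''e'' := Num (int e))"
    have env: "reduction_env ?\<sigma>" using assms by (rule reduction_env_upd) simp
    have u: "den ?u ?\<sigma> = Num (int (e div ?N))"
      by (intro den_Div den_points_expr env) simp
    have v: "den ?v ?\<sigma> = Num (int (e mod ?N))" if "reduction_env \<sigma>'" "\<sigma>' ''e'' = Num (int e)" for \<sigma>'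
      by (intro den_Mod den_points_expr env) simp
    show "holds (not_expr (eq_expr ?u ?v)) ?\<sigma> \<longleftrightarrow> e div ?N \<noteq> e mod ?N"
      unfolding holds_not using holds_eq[OF u v] env by simp
    let ?\<sigma>u = "?\<sigma>(''u'' := Num (int (e div ?N)))"
    have env_u: "reduction_env ?\<sigma>u" using env by (rule reduction_env_upd) simp
    let ?\<sigma>v = "?\<sigma>u(''v'' := Num (int (e mod ?N)))"
    have env_v: "reduction_env ?\<sigma>v" using env_u by (rule reduction_env_upd) simp
    have "den (edge_expr (BVar ''u'') (BVar ''v'')) ?\<sigma>v = Num (int (edge_length \<phi> L (e div ?N) (e mod ?N)))"
      using e m_pos by (intro den_edge_expr env_v) (simp_all add: less_mult_imp_div_less)
    then have "den warc_expr ?\<sigma>v = enc_warc ((e div ?N, e mod ?N), of_nat (edge_length \<phi> L (e div ?N) (e mod ?N)))"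
      by (simp add: warc_expr_def enc_warc_def enc_rat_of_nat enc_nat_def)
    moreover have "den ?v ?\<sigma>u = Num (int (e mod ?N))"
      by (intro den_Mod den_points_expr env_u) simp
    ultimately show "den (BLet ''u'' ?u (BLet ''v'' ?v warc_expr)) ?\<sigma> =
        enc_warc ((e div ?N, e mod ?N), of_nat (edge_length \<phi> L (e div ?N) (e mod ?N)))"
      unfolding den.simps(6) u by simp
  qed simp
  then show ?thesis by (simp add: reduction_def Let_def)
qed

lemma den_clients_expr:
  assumes "reduction_env \<sigma>"
  shows "den clients_expr \<sigma> = enc_list enc_nat (clients I)"
proof -
  have "den clients_expr \<sigma> = enc_list enc_nat (map (\<lambda>j. 9 * j + 8) (filter (\<lambda>_. True) [0..<m]) @ [])"
    unfolding clients_expr_def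
    by (rule den_BTab) (use assms in \<open>simp_all add: reduction_env_def enc_nat_def\<close>)
  then show ?thesis by (simp add: reduction_def Let_def)
qed

lemma den_facilities_expr:
  assumes "reduction_env \<sigma>"
  shows "den facilities_expr \<sigma> = enc_list enc_nat (facilities I)"
proof -
  have "den facilities_expr \<sigma> = enc_list enc_nat (map (\<lambda>v. v) (filter (\<lambda>v. v mod 9 \<noteq> 8) [0..<9 * m]) @ [])"
    unfolding facilities_expr_def
  proof (rule den_BTab)
    fix v
    let ?\<sigma> = "\<sigma>(''e'' := Num (int v))"
    have "den (BVar ''e'') ?\<sigma> = Num (int v)" by simp
    from holds_eq[OF den_mod9_expr[OF this] den_nat_const[of 8]]
    show "holds (not_expr (eq_expr (mod9_expr (BVar ''e'')) (BConst (int 8)))) ?\<sigma> \<longleftrightarrow> v mod 9 \<noteq> 8"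
      unfolding holds_not by simp
  qed (simp_all add: den_points_expr[OF assms] enc_nat_def)
  then show ?thesis by (simp add: reduction_def Let_def)
qed

lemma den_group_expr:
  assumes "reduction_env \<sigma>" "\<sigma> ''e'' = Num (int e)"
  shows "den group_expr \<sigma> = enc_group (conflict_group \<phi> (e div (m * m)) (e div m mod m) (e mod m),
    0, conflict_limit (e div m mod m) (e mod m))"
proof -
  define x i j where "x = e div (m * m)" and "i = e div m mod m" and "j = e mod m"
  define \<sigma>' where "\<sigma>' = \<sigma>(''x'' := Num (int x), ''i'' := Num (int i), ''j'' := Num (int j))"
  have env: "reduction_env \<sigma>'"
    unfolding \<sigma>'_def using assms(1) by (intro reduction_env_upd) simp_all
  have vars: "\<sigma>' ''x'' = Num (int x)" "\<sigma>' ''i'' = Num (int i)" "\<sigma>' ''j'' = Num (int j)"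
    by (simp_all add: \<sigma>'_def)
  have e: "den (BVar ''e'') \<sigma> = Num (int e)" "den (BVar ''m'') \<sigma> = Num (int m)"
    using assms by (simp_all add: reduction_env_def)
  have body: "den group_expr \<sigma> = den (BBinary MkNode
      (BTab ''v'' points_expr conflict_mem_expr (BVar ''v'') (BConst 0))
      (BBinary MkNode (BConst 0) (BCond (eq_expr (BVar ''i'') (BVar ''j'')) (BConst 0) (BConst 1)))) \<sigma>'"
    using assms(2) assms(1)
    by (simp add: group_expr_def reduction_env_def \<sigma>'_def x_def i_def j_def zdiv_int zmod_int)
  have list: "den (BTab ''v'' points_expr conflict_mem_expr (BVar ''v'') (BConst 0)) \<sigma>' =
      enc_list enc_nat (map (\<lambda>v. v) (conflict_group \<phi> x i j) @ [])"
    unfolding conflict_group_def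
  proof (rule den_BTab)
    show "den points_expr \<sigma>' = Num (int (9 * m))" using env by (rule den_points_expr)
    fix v assume v: "v < 9 * m"
    let ?\<sigma> = "\<sigma>'(''v'' := Num (int v))"
    have env_v: "reduction_env ?\<sigma>" using env by (rule reduction_env_upd) simp
    have dens: "den (BVar ''v'') ?\<sigma> = Num (int v)" "den (BVar ''x'') ?\<sigma> = Num (int x)"
      "den (BVar ''i'') ?\<sigma> = Num (int i)" "den (BVar ''j'') ?\<sigma> = Num (int j)"
      using vars by simp_all
    have if_holds: "holds (BCond c p q) \<tau> \<longleftrightarrow> (if holds c \<tau> then holds p \<tau> else holds q \<tau>)" for c p q \<tau>
      by simp
    show "holds conflict_mem_expr ?\<sigma> \<longleftrightarrow> v mod 9 \<noteq> 8 \<and>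
      (if i = j then v div 9 = i \<and> asserts \<phi> True x v \<and> asserts \<phi> False x v
       else v div 9 = i \<and> asserts \<phi> True x v \<or> v div 9 = j \<and> asserts \<phi> False x v)"
      unfolding conflict_mem_expr_def Let_def holds_and holds_not if_holds holds_or
        holds_eq[OF den_mod9_expr[OF dens(1)] den_nat_const]
        holds_eq[OF dens(3,4)] holds_eq[OF den_div9_expr[OF dens(1)] dens(3)]
        holds_eq[OF den_div9_expr[OF dens(1)] dens(4)]
        holds_asserts_expr[OF env_v dens(1) v dens(2)]
      by (rule refl)
  qed (simp_all add: enc_nat_def)
  have limit: "den (BCond (eq_expr (BVar ''i'') (BVar ''j'')) (BConst 0) (BConst 1)) \<sigma>' =
      Num (conflict_limit i j)"
    using holds_eq[of "BVar ''i''" \<sigma>' i "BVar ''j''" j] vars by (simp add: conflict_limit_def)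
  show ?thesis
    unfolding body den.simps(4) list limit x_def[symmetric] i_def[symmetric] j_def[symmetric]
    by (simp add: enc_group_def)
qed

lemma den_groups_expr:
  assumes "reduction_env \<sigma>"
  shows "den (clause_groups_expr conflict_groups_expr) \<sigma> = enc_list enc_group (groups I)"
proof -
  let ?f = "\<lambda>e. (conflict_group \<phi> (e div (m * m)) (e div m mod m) (e mod m), 0 :: int,
      conflict_limit (e div m mod m) (e mod m))"
  have conflict: "den conflict_groups_expr \<sigma> =
      enc_list enc_group (map ?f (filter (\<lambda>_. True) [0..<num_vars \<phi> * (m * m)]) @ [])"
    unfolding conflict_groups_expr_def
  proof (rule den_BTab)
    show "den (BBinary Times (BUnary Head (BVar ''in'')) (BBinary Times (BVar ''m'') (BVar ''m''))) \<sigma> =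
        Num (int (num_vars \<phi> * (m * m)))"
      using assms by (simp add: reduction_env_def enc_sat3_def enc_nat_def)
    fix e
    show "den group_expr (\<sigma>(''e'' := Num (int e))) = enc_group (?f e)"
      by (rule den_group_expr) (simp_all add: reduction_env_upd[OF assms])
  qed simp_all
  have "den (clause_groups_expr conflict_groups_expr) \<sigma> =
      enc_list enc_group (map (\<lambda>j. (clause_group j, 1, 1)) (filter (\<lambda>_. True) [0..<m]) @
        (map ?f (filter (\<lambda>_. True) [0..<num_vars \<phi> * (m * m)]) @ []))"
    unfolding clause_groups_expr_def
  proof (rule den_BTab)
    show "den (BVar ''m'') \<sigma> = Num (int m)" using assms by (simp add: reduction_env_def)
    fix j
    let ?\<sigma> = "\<sigma>(''e'' := Num (int j))"
    have "den (BTab ''v'' (BConst (int 8)) (BConst 1)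
        (BBinary Plus (BBinary Times (BConst (int 9)) (BVar ''e'')) (BVar ''v'')) (BConst 0)) ?\<sigma> =
        enc_list enc_nat (map (\<lambda>r. 9 * j + r) (filter (\<lambda>_. True) [0..<8]) @ [])"
      by (rule den_BTab) (simp_all add: enc_nat_def)
    then show "den (BBinary MkNode (BTab ''v'' (BConst (int 8)) (BConst 1)
        (BBinary Plus (BBinary Times (BConst (int 9)) (BVar ''e'')) (BVar ''v'')) (BConst 0))
        (BBinary MkNode (BConst 1) (BConst 1))) ?\<sigma> = enc_group (clause_group j, 1, 1)"
      unfolding den.simps(4) by (simp add: enc_group_def clause_group_def)
  qed (simp_all add: conflict)
  then show ?thesis by (simp add: reduction_def Let_def)
qed

lemma den_reduction_expr:
  assumes "\<And>\<sigma>. \<sigma> ''m'' = Num (int m) \<Longrightarrow> den len \<sigma> = Num (int L)"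
  shows "den (reduction_expr len) (input_env (enc_sat3 \<phi>)) = enc_inst I"
proof -
  define \<sigma> where "\<sigma> = (input_env (enc_sat3 \<phi>))(''m'' := Num (int m), ''L'' := Num (int L))"
  have env: "reduction_env \<sigma>"
    by (simp add: \<sigma>_def reduction_env_def input_env_def)
  have n: "den (BBinary Plus points_expr (BConst (int 1))) \<sigma> = Num (int (9 * m + 1))"
    by (intro den_Plus den_points_expr env den_nat_const)
  have "den (reduction_expr len) (input_env (enc_sat3 \<phi>)) = den (foldr (BBinary MkNode)
      [BVar ''m'', BBinary Plus points_expr (BConst (int 1)), warcs_expr, clients_expr,
       facilities_expr, clause_groups_expr conflict_groups_expr] (BConst 0)) \<sigma>"
    by (simp add: reduction_expr_def assms \<sigma>_def input_env_def enc_sat3_def spine_enc_list num_clauses_def)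
  also have "\<dots> = enc_list id [Num (int m), Num (int (9 * m + 1)), enc_list enc_warc (warcs I),
      enc_list enc_nat (clients I), enc_list enc_nat (facilities I), enc_list enc_group (groups I)]"
    using env n unfolding foldr.simps comp_apply den.simps(4) id_apply
    by (simp add: den_warcs_expr den_clients_expr den_facilities_expr den_groups_expr del: den.simps(4))
      (simp add: reduction_env_def)
  also have "\<dots> = enc_inst I"
    by (simp add: enc_inst_def enc_nat_def)
  finally show ?thesis .
qed

section \<open>The feasible solution and the sizes that enter the time bounds\<close>

lemma den_solution_expr:
  "den solution_expr (input_env (enc_inst I)) = enc_list enc_nat (map (\<lambda>j. 9 * j) [0..<m])"
proof -
  have "den solution_expr (input_env (enc_inst I)) =
      enc_list enc_nat (map (\<lambda>j. 9 * j) (filter (\<lambda>_. True) [0..<m]) @ [])"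
    unfolding solution_expr_def
    by (rule den_BTab) (simp_all add: input_env_def enc_inst_def enc_nat_def)
  then show ?thesis by simp
qed

lemma feasible_solution: "feasible I (set (map (\<lambda>j. 9 * j) [0..<m]))"
  using feasible_chosen[of "\<lambda>_. False"] by (simp add: chosen_def pack_def atLeast0LessThan)

text \<open>A clause supplies a literal, so both \<open>m\<close> and \<open>num_vars \<phi>\<close>
  are at least 1 and each lower-order term can be charged to their product: 23 = 1 + 5 + 3 +
  14.\<close>

lemma usize_enc_sat3: "usize (enc_sat3 \<phi>) + 2 \<le> 23 * (m * num_vars \<phi>)"
proof -
  have n_pos: "num_vars \<phi> \<ge> 1"
    using lit_var_less[of 0 0] m_pos by simp
  have literal: "usize (enc_literal l) \<le> num_vars \<phi> + 3" if "lit_var l < num_vars \<phi>" for l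
    using that by (cases l) (auto simp: enc_nat_def)
  have "usize (enc_clause c) \<le> 3 * num_vars \<phi> + 13"
    if "\<forall>l \<in> clause_lits c. lit_var l < num_vars \<phi>" for c
  proof -
    obtain l1 l2 l3 where c: "c = (l1, l2, l3)" by (cases c)
    then show ?thesis
      using that literal[of l1] literal[of l2] literal[of l3] by simp
  qed
  then have "\<forall>c \<in> set (clauses \<phi>). usize (enc_clause c) \<le> 3 * num_vars \<phi> + 13"
    using wf by (simp add: wf_sat3_def)
  then have "usize (enc_list enc_clause cs) \<le> length cs * (3 * num_vars \<phi> + 14) + 1"
    if "set cs \<subseteq> set (clauses \<phi>)" for cs
    using that by (induction cs) fastforce+
  from this[of "clauses \<phi>"]
  have "usize (enc_list enc_clause (clauses \<phi>)) \<le> m * (3 * num_vars \<phi> + 14) + 1"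
    by (simp add: num_clauses_def)
  then have "usize (enc_sat3 \<phi>) + 2 \<le> num_vars \<phi> + 5 + m * (3 * num_vars \<phi> + 14)"
    by (simp add: enc_sat3_def enc_nat_def)
  also have "\<dots> \<le> 23 * (m * num_vars \<phi>)"
  proof -
    have "m \<le> m * num_vars \<phi>" "num_vars \<phi> \<le> m * num_vars \<phi>"
      using n_pos m_pos by simp_all
    moreover have "m * (3 * num_vars \<phi> + 14) = 3 * (m * num_vars \<phi>) + 14 * m"
      by (simp add: algebra_simps)
    ultimately show ?thesis using m_pos by linarith
  qed
  finally show ?thesis .
qed

text \<open>Every group contributes to the bit size, and there are at least
  \<open>m * num_vars \<phi>\<close> of them. This turns bounds in terms of the formula into bounds
  in the bit size of the instance.\<close>

lemma product_le_vsize: "m * num_vars \<phi> \<le> vsize (enc_inst I)"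
proof -
  have "length xs \<le> vsize (enc_list enc xs)" for enc :: "'a \<Rightarrow> val" and xs
    by (induction xs) auto
  then have "length (groups I) \<le> vsize (enc_list enc_group (groups I))" .
  moreover have "\<dots> \<le> vsize (enc_inst I)" by (simp add: enc_inst_def)
  moreover have "num_vars \<phi> * m \<le> length (groups I)"
    using m_pos by (auto simp: length_groups power2_eq_square intro: trans_le_add2)
  ultimately show ?thesis by (simp add: mult.commute)
qed

end

section \<open>The hardness gap\<close>

context reduction_instance
begin

text \<open>More than \<open>(1 / 8 - \<epsilon>) * m\<close> clauses are falsified, and each of
  their clients pays \<open>L\<close>, which is at least \<open>(G - 2) / 2\<close>.\<close>

lemma cost_ge_of_unsatisfiable:
  assumes sat: "\<And>A. real (num_sat \<phi> A) < (7 / 8 + \<epsilon>) * real m"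
    and "\<epsilon> > 0" and G: "G \<le> 2 * real L + 2" and large: "7 / 8 + \<epsilon> \<le> 1 \<or> G \<ge> 2"
    and S: "feasible I S"
  shows "cost I S > ereal ((1 - 8 * \<epsilon>) * ((G - 2) / 16) * real m)"
proof -
  obtain A where A: "S = chosen A ` {..<m}" using feasible_imp_chosen[OF S] .
  define u where "u = real (m - num_sat \<phi> A)"
  have u: "u = real m - real (num_sat \<phi> A)"
    using num_sat_le[of A] by (simp add: u_def of_nat_diff)
  have "u \<ge> 0" by (simp add: u_def)
  have L: "real L \<ge> 1" using L_ge_1 by simp
  have cost_ge: "real m \<le> real (num_sat \<phi> A) + real L * u"
    using mult_right_mono[OF L \<open>u \<ge> 0\<close>] u by simp
  \<comment> \<open>If the product of the two factors is not positive, neither is the claimed bound,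
    and the trivial cost \<open>m\<close> beats it. Otherwise both are positive, as
    \<open>large\<close> excludes two negative factors.\<close>
  have "(1 - 8 * \<epsilon>) * ((G - 2) / 16) * real m < real (num_sat \<phi> A) + real L * u"
  proof (cases "(1 - 8 * \<epsilon>) * (G - 2) > 0")
    case False
    then have "(1 - 8 * \<epsilon>) * ((G - 2) / 16) * real m \<le> 0"
      using mult_nonpos_nonneg[of "(1 - 8 * \<epsilon>) * (G - 2) / 16" "real m"] by simp
    then show ?thesis using cost_ge m_pos by linarith
  next
    case True
    then have "G > 2" "1 - 8 * \<epsilon> > 0"
      using large by (auto simp: zero_less_mult_iff)
    have "(1 - 8 * \<epsilon>) * real m < 8 * u"
      using sat[of A] u by (simp add: algebra_simps)
    then have "(1 - 8 * \<epsilon>) * real m * ((G - 2) / 16) < 8 * u * ((G - 2) / 16)"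
      using \<open>G > 2\<close> by (intro mult_strict_right_mono) auto
    also have "\<dots> = u * ((G - 2) / 2)" by simp
    also have "\<dots> \<le> u * real L"
      using G \<open>u \<ge> 0\<close> by (intro mult_left_mono) auto
    finally show ?thesis by (simp add: mult_ac)
  qed
  then show ?thesis
    unfolding A cost_chosen u_def by simp
qed

end

text \<open>The lower bound 1 on \<open>g\<close> reflects that no aspect ratio is below 1. The last
  hypothesis excludes a contradiction: for \<epsilon> > 1/8 the premise of the gap holds even for
  satisfiable formulas, and if also \<open>g n < 2\<close>, the two negative factors can push the
  claimed cost above the cost \<open>k\<close> of a satisfying assignment.\<close>

theorem theorem8:
  fixes P :: "real poly" and g :: "nat \<Rightarrow> real" and \<epsilon> :: real
  assumes "\<And>n. g n = poly P (real n)"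
    and "\<And>n. n \<ge> 1 \<Longrightarrow> g n > 0"
    and "\<And>m. m \<ge> 1 \<Longrightarrow> g (9 * m + 1) \<ge> 1"
    and "\<epsilon> > 0"
    and "7 / 8 + \<epsilon> \<le> 1 \<or> (\<forall>m \<ge> 1. g (9 * m + 1) \<ge> 2)"
  shows "\<exists>(p :: prog) (R :: sat3 \<Rightarrow> fr_inst) a b.
    (\<forall>\<phi>. wf_sat3 \<phi> \<longrightarrow>
       (\<exists>t. runs p (enc_sat3 \<phi>) (enc_inst (R \<phi>)) t \<and>
            t \<le> a * (num_clauses \<phi> * num_vars \<phi>) ^ b)) \<and>
    g_FR_k_Med_O g (R ` {\<phi>. wf_sat3 \<phi>}) \<and>
    (\<forall>\<phi>. wf_sat3 \<phi> \<longrightarrow>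
       (let I = R \<phi>; m = num_clauses \<phi>; n = num_verts I; k = budget I in
          card (set (clients I)) = m \<and> card (set (facilities I)) = 8 * m \<and> n = 9 * m + 1 \<and>
          k = m \<and> length (groups I) \<le> 2 * num_vars \<phi> * m ^ 2 + m \<and>
          ((\<exists>A. num_sat \<phi> A = m) \<longrightarrow>
             (\<exists>S. feasible I S \<and> cost I S \<le> ereal (real k))) \<and>
          ((\<forall>A. real (num_sat \<phi> A) < (7 / 8 + \<epsilon>) * real m) \<longrightarrow>
             (\<forall>S. feasible I S \<longrightarrow>
                cost I S > ereal ((1 - 8 * \<epsilon>) * ((g n - 2) / 16) * real k)))))"
proof -
  have "poly P (real n) > 0" if "n \<ge> 1" for n
    using assms(2)[OF that] by (simp add: assms(1))
  moreover have "poly P (real (9 * m + 1)) \<ge> 1" if "m \<ge> 1" for m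
    using assms(3)[OF that] by (simp only: assms(1))
  ultimately obtain L where L: "expressible L"
    "\<And>m. m \<ge> 1 \<Longrightarrow> L m \<ge> 1 \<and> real (L m) \<le> g (9 * m + 1) \<and> g (9 * m + 1) \<le> 2 * real (L m) + 2"
    unfolding assms(1) using expressible_approximation by metis
  obtain len where len: "\<And>\<sigma> m. \<sigma> ''m'' = Num (int m) \<Longrightarrow> den len \<sigma> = Num (int (L m))"
    using L(1) unfolding expressible_def by blast
  define R where "R \<phi> = reduction \<phi> (L (num_clauses \<phi>))" for \<phi>
  have red: "reduction_instance \<phi> (L (num_clauses \<phi>))" if "wf_sat3 \<phi>" for \<phi>
  proof
    have "num_clauses \<phi> \<ge> 1" using that by (simp add: wf_sat3_def num_clauses_def Suc_le_eq)
    then show "L (num_clauses \<phi>) \<ge> 1" using L(2) by blast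
  qed fact
  have pos: "num_clauses \<phi> \<ge> 1" if "wf_sat3 \<phi>" for \<phi>
    using reduction_instance.m_pos[OF red[OF that]] by simp
  have den_R: "den (reduction_expr len) (input_env (enc_sat3 \<phi>)) = enc_inst (R \<phi>)" if "wf_sat3 \<phi>" for \<phi>
    unfolding R_def by (rule reduction_instance.den_reduction_expr[OF red[OF that]]) (rule len)
  obtain b where b: "\<And>v. \<exists>t. runs (program (reduction_expr len)) v (den (reduction_expr len) (input_env v)) t \<and>
      t \<le> (usize v + 2) ^ b"
    "\<And>v. usize (den (reduction_expr len) (input_env v)) \<le> (usize v + 2) ^ b"
    using runs_poly_time[of "reduction_expr len"] by blast
  obtain c where c: "\<And>v. \<exists>t. runs (program solution_expr) v (den solution_expr (input_env v)) t \<and>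
      t \<le> (usize v + 2) ^ c"
    using runs_poly_time[of solution_expr] by blast
  have input: "(usize (enc_sat3 \<phi>) + 2) ^ b \<le> 23 ^ b * (num_clauses \<phi> * num_vars \<phi>) ^ b"
    if "wf_sat3 \<phi>" for \<phi>
    using reduction_instance.usize_enc_sat3[OF red[OF that]]
    by (subst power_mult_distrib[symmetric]) (rule power_mono, simp_all)
  have time: "\<exists>t. runs (program (reduction_expr len)) (enc_sat3 \<phi>) (enc_inst (R \<phi>)) t \<and>
      t \<le> 23 ^ b * (num_clauses \<phi> * num_vars \<phi>) ^ b" if "wf_sat3 \<phi>" for \<phi>
    using b(1)[of "enc_sat3 \<phi>"] input[OF that] unfolding den_R[OF that] by (meson order_trans)
  have solve: "\<exists>S t. runs (program solution_expr) (enc_inst (R \<phi>)) (enc_list enc_nat S) t \<and>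
      feasible (R \<phi>) (set S) \<and> t \<le> (3 * 23 ^ b) ^ c * vsize (enc_inst (R \<phi>)) ^ (b * c)"
    if "wf_sat3 \<phi>" for \<phi>
  proof -
    interpret reduction_instance \<phi> "L (num_clauses \<phi>)" by (rule red[OF that])
    let ?S = "map (\<lambda>j. 9 * j) [0..<num_clauses \<phi>]"
    let ?V = "vsize (enc_inst (R \<phi>))"
    obtain t where t: "runs (program solution_expr) (enc_inst (R \<phi>)) (enc_list enc_nat ?S) t"
      "t \<le> (usize (enc_inst (R \<phi>)) + 2) ^ c"
      using c[of "enc_inst (R \<phi>)"] den_solution_expr unfolding R_def by auto
    \<comment> \<open>The time of the solver is known in the unary size of its input. That size is
      polynomial in the product of clauses and variables, since a compiled program produced the
      instance, and the product is at most the bit size.\<close>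
    have "usize (enc_inst (R \<phi>)) \<le> 23 ^ b * (num_clauses \<phi> * num_vars \<phi>) ^ b"
      using b(2)[of "enc_sat3 \<phi>"] input[OF that] unfolding den_R[OF that] by (rule order_trans)
    also have "\<dots> \<le> 23 ^ b * ?V ^ b"
      using product_le_vsize unfolding R_def by (intro mult_left_mono power_mono) auto
    finally have "usize (enc_inst (R \<phi>)) + 2 \<le> 23 ^ b * ?V ^ b + 2" by simp
    also have "\<dots> \<le> 3 * 23 ^ b * ?V ^ b"
    proof -
      have "?V \<ge> 1" by (cases "enc_inst (R \<phi>)") auto
      then have "1 \<le> 23 ^ b * ?V ^ b" by simp
      then show ?thesis by linarith
    qed
    finally have "(usize (enc_inst (R \<phi>)) + 2) ^ c \<le> (3 * 23 ^ b * ?V ^ b) ^ c"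
      by (rule power_mono) simp
    also have "\<dots> = (3 * 23 ^ b) ^ c * ?V ^ (b * c)"
      by (simp add: power_mult_distrib power_mult)
    finally show ?thesis
      using t feasible_solution unfolding R_def[symmetric] by (meson order_trans)
  qed
  have "g_FR_k_Med_O g (R ` {\<phi>. wf_sat3 \<phi>})"
    unfolding g_FR_k_Med_O_def FR_k_Med_O_def
  proof (intro conjI)
    show "\<forall>I\<in>R ` {\<phi>. wf_sat3 \<phi>}. wf_inst I"
      unfolding R_def using reduction_instance.wf_inst_I[OF red] by auto
    show "\<forall>I\<in>R ` {\<phi>. wf_sat3 \<phi>}. aspect_ratio I \<le> g (num_verts I)"
    proof clarify
      fix \<phi> assume \<phi>: "wf_sat3 \<phi>"
      interpret reduction_instance \<phi> "L (num_clauses \<phi>)" by (rule red[OF \<phi>])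
      show "aspect_ratio (R \<phi>) \<le> g (num_verts (R \<phi>))"
        using aspect_ratio_le L(2)[OF pos[OF \<phi>]] by (simp add: R_def)
    qed
    show "\<exists>q a b. \<forall>I\<in>R ` {\<phi>. wf_sat3 \<phi>}. \<exists>S t. runs q (enc_inst I) (enc_list enc_nat S) t \<and>
        feasible I (set S) \<and> t \<le> a * vsize (enc_inst I) ^ b"
      using solve by blast
  qed
  moreover have "let I = R \<phi>; m = num_clauses \<phi>; n = num_verts I; k = budget I in
          card (set (clients I)) = m \<and> card (set (facilities I)) = 8 * m \<and> n = 9 * m + 1 \<and>
          k = m \<and> length (groups I) \<le> 2 * num_vars \<phi> * m ^ 2 + m \<and>
          ((\<exists>A. num_sat \<phi> A = m) \<longrightarrow>
             (\<exists>S. feasible I S \<and> cost I S \<le> ereal (real k))) \<and>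
          ((\<forall>A. real (num_sat \<phi> A) < (7 / 8 + \<epsilon>) * real m) \<longrightarrow>
             (\<forall>S. feasible I S \<longrightarrow>
                cost I S > ereal ((1 - 8 * \<epsilon>) * ((g n - 2) / 16) * real k)))"
    if \<phi>: "wf_sat3 \<phi>" for \<phi>
  proof -
    interpret reduction_instance \<phi> "L (num_clauses \<phi>)" by (rule red[OF \<phi>])
    have "\<exists>S. feasible I S \<and> cost I S \<le> ereal (real m)" if "num_sat \<phi> A = m" for A
      using feasible_chosen[of A] cost_chosen[of A] that by (auto intro: exI[of _ "chosen A ` {..<m}"])
    moreover have "cost I S > ereal ((1 - 8 * \<epsilon>) * ((g (9 * m + 1) - 2) / 16) * real m)"
      if "\<forall>A. real (num_sat \<phi> A) < (7 / 8 + \<epsilon>) * real m" "feasible I S" for S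
      using that L(2)[OF pos[OF \<phi>]] assms(5) pos[OF \<phi>]
      by (intro cost_ge_of_unsatisfiable \<open>\<epsilon> > 0\<close>) auto
    ultimately show ?thesis
      unfolding R_def Let_def by (auto simp: card_clients card_facilities length_groups)
  qed
  ultimately show ?thesis
    using time by blast
qed

end
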